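(* Let $\mathfrak{g}$ be the insertion-elimination algebra and $\mathrm{Aut}_{\mathbb{C}}(\mathfrak{g})$ its group of $\mathbb{C}$-linear Lie algebra automorphisms. The center of $\mathrm{Aut}_{\mathbb{C}}(\mathfrak{g})$ is $\{\mathrm{id}_{\mathfrak{g}},\tau_{-1}\}$, where $\tau_{-1}$ is the automorphism with $\tau_{-1}(d)=d$, $\tau_{-1}(D_t^+)=(-1)^{|t|}D_t^+$, $\tau_{-1}(D_t^-)=(-1)^{-|t|}D_t^-$ for all $t\in\mathbb{T}$.
   Context: A rooted tree is a finite connected undirected cycle-free graph $t$ with a distinguished vertex $\mathrm{rt}(t)$, its root. Rooted trees are considered up to (root-preserving graph) isomorphism; equality of rooted trees means isomorphism, and $\mathbb{T}$ is the set of all isomorphism classes of rooted trees. $V(t)$ and $E(t)$ are the sets of vertices and edges of $t$, and $|t|$ is the cardinality of $V(t)$. For $e\in E(t)$, removing $e$ divides $t$ into two rooted subtrees: $R_e(t)$ is the one containing $\mathrm{rt}(t)$, and $P_e(t)$ is the other one; a subtree is rooted at its vertex at minimal distance in $t$ from $\mathrm{rt}(t)$. For $s,t\in\mathbb{T}$ and $v\in V(s)$, $s\cup_v t$ is the rooted tree obtained by joining the root of $t$ to $s$ at $v$ by a single new edge, with root $\mathrm{rt}(s)$. For $t_1,t_2,t_3\in\mathbb{T}$ put $$\alpha(t_1,t_2,t_3)=|\{e\in E(t_2)\mid R_e(t_2)=t_3,\ P_e(t_2)=t_1\}|,\qquad \beta(t_1,t_2,t_3)=|\{v\in V(t_3)\mid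 t_1=t_3\cup_v t_2\}|.$$ The insertion-elimination algebra $\mathfrak{g}$ is the Lie algebra over $\mathbb{C}$ with basis $\{d\}\cup\{D_t^{+},D_t^-\mid t\in\mathbb{T}\}$ and relations, for $s,t\in\mathbb{T}$: $[D_s^+,D_t^+]=\sum_{r\in\mathbb{T}}(\beta(r,s,t)-\beta(r,t,s))D_r^+$; $[D_s^-,D_t^-]=\sum_{r\in\mathbb{T}}(\alpha(t,r,s)-\alpha(s,r,t))D_r^-$; $[D_s^-,D_t^+]=\sum_{r\in\mathbb{T}}\alpha(s,t,r)D_r^++\sum_{r\in\mathbb{T}}\beta(s,t,r)D_r^-$ for $s\neq t$; $[D_t^-,D_t^+]=d$; $[d,D_t^-]=-|t|D_t^-$; $[d,D_t^+]=|t|D_t^+$. *)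

theory Defs
  imports Complex_Main "HOL-Library.Poly_Mapping" "HOL-Algebra.Group"
begin

section \<open>Rooted trees\<close>

datatype 'v rgraph = RGraph (verts: "'v set") (edges: "'v set set") (rt: 'v)

definition adj :: "'v set set \<Rightarrow> 'v rel" where
  "adj E = {(x, y). {x, y} \<in> E}"

definition connected_graph :: "'v rgraph \<Rightarrow> bool" where
  "connected_graph G \<longleftrightarrow> (\<forall>u\<in>verts G. \<forall>v\<in>verts G. (u, v) \<in> (adj (edges G))\<^sup>*)"

definition is_cycle :: "'v rgraph \<Rightarrow> 'v list \<Rightarrow> bool" where
  "is_cycle G p \<longleftrightarrow> length p \<ge> 3 \<and> distinct p \<and> set p \<subseteq> verts G \<and>
     (\<forall>i. Suc i < length p \<longrightarrow> {p ! i, p ! Suc i} \<in> edges G) \<and> {last p, hd p} \<in> edges G"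

definition rooted_tree :: "'v rgraph \<Rightarrow> bool" where
  "rooted_tree G \<longleftrightarrow> finite (verts G) \<and> rt G \<in> verts G \<and>
     edges G \<subseteq> {{u, v} | u v. u \<in> verts G \<and> v \<in> verts G \<and> u \<noteq> v} \<and>
     connected_graph G \<and> (\<nexists>p. is_cycle G p)"

definition rgraph_iso :: "'v rgraph \<Rightarrow> 'w rgraph \<Rightarrow> bool" (infix \<open>\<cong>\<^sub>r\<close> 50) where
  "G \<cong>\<^sub>r H \<longleftrightarrow> (\<exists>\<phi>. bij_betw \<phi> (verts G) (verts H) \<and> \<phi> (rt G) = rt H \<and>
     (\<forall>u\<in>verts G. \<forall>v\<in>verts G. {u, v} \<in> edges G \<longleftrightarrow> {\<phi> u, \<phi> v} \<in> edges H))"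

lemma rgraph_iso_refl: "G \<cong>\<^sub>r G"
  unfolding rgraph_iso_def by (rule exI[of _ id]) auto

lemma rgraph_iso_sym:
  assumes "G \<cong>\<^sub>r H" "rt G \<in> verts G"
  shows "H \<cong>\<^sub>r G"
proof -
  from assms(1) obtain \<phi> where b: "bij_betw \<phi> (verts G) (verts H)" and r: "\<phi> (rt G) = rt H"
    and e: "\<And>u v. u \<in> verts G \<Longrightarrow> v \<in> verts G \<Longrightarrow> {u, v} \<in> edges G \<longleftrightarrow> {\<phi> u, \<phi> v} \<in> edges H"
    unfolding rgraph_iso_def by blast
  let ?\<psi> = "the_inv_into (verts G) \<phi>"
  have b': "bij_betw ?\<psi> (verts H) (verts G)"
    by (rule bij_betw_the_inv_into[OF b])
  have "?\<psi> (rt H) = rt G"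
    using b r assms(2) by (metis bij_betw_imp_inj_on the_inv_into_f_f)
  moreover have "{u, v} \<in> edges H \<longleftrightarrow> {?\<psi> u, ?\<psi> v} \<in> edges G" if "u \<in> verts H" "v \<in> verts H" for u v
    using e[of "?\<psi> u" "?\<psi> v"] that bij_betwE[OF b'] f_the_inv_into_f_bij_betw[OF b] by simp
  ultimately show ?thesis
    using b' unfolding rgraph_iso_def by blast
qed

lemma rgraph_iso_trans:
  assumes "G \<cong>\<^sub>r H" "H \<cong>\<^sub>r K"
  shows "G \<cong>\<^sub>r K"
proof -
  from assms(1) obtain \<phi> where b: "bij_betw \<phi> (verts G) (verts H)" and r: "\<phi> (rt G) = rt H"
    and e: "\<And>u v. u \<in> verts G \<Longrightarrow> v \<in> verts G \<Longrightarrow> {u, v} \<in> edges G \<longleftrightarrow> {\<phi> u, \<phi> v} \<in> edges H"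
    unfolding rgraph_iso_def by blast
  from assms(2) obtain \<psi> where b': "bij_betw \<psi> (verts H) (verts K)" and r': "\<psi> (rt H) = rt K"
    and e': "\<And>u v. u \<in> verts H \<Longrightarrow> v \<in> verts H \<Longrightarrow> {u, v} \<in> edges H \<longleftrightarrow> {\<psi> u, \<psi> v} \<in> edges K"
    unfolding rgraph_iso_def by blast
  have "bij_betw (\<psi> \<circ> \<phi>) (verts G) (verts K)"
    using b b' by (rule bij_betw_trans)
  moreover have "{u, v} \<in> edges G \<longleftrightarrow> {(\<psi> \<circ> \<phi>) u, (\<psi> \<circ> \<phi>) v} \<in> edges K"
    if "u \<in> verts G" "v \<in> verts G" for u v
    using e[OF that] e'[of "\<phi> u" "\<phi> v"] that b by (simp add: bij_betwE)
  ultimately show ?thesis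
    using r r' unfolding rgraph_iso_def by (intro exI[of _ "\<psi> \<circ> \<phi>"]) auto
qed

lemma rooted_tree_rt: "rooted_tree G \<Longrightarrow> rt G \<in> verts G"
  by (simp add: rooted_tree_def)

lemma rooted_tree_singleton: "rooted_tree (RGraph {v} {} v)"
  by (auto simp: rooted_tree_def connected_graph_def is_cycle_def)

text \<open>Every finite rooted tree is isomorphic to one whose vertices are natural numbers, so the
  isomorphism classes of such trees are all isomorphism classes of rooted trees.\<close>

quotient_type rtree = "nat rgraph" / partial:
  "\<lambda>G H. rooted_tree G \<and> rooted_tree H \<and> G \<cong>\<^sub>r H"
proof (rule part_equivpI)
  show "\<exists>G :: nat rgraph. rooted_tree G \<and> rooted_tree G \<and> G \<cong>\<^sub>r G"
    
    using rooted_tree_singleton[of 0] rgraph_iso_refl[of "RGraph {0} {} 0"]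
    by (intro exI[of _ "RGraph {0} {} 0"]) simp
  show "symp (\<lambda>G H :: nat rgraph. rooted_tree G \<and> rooted_tree H \<and> G \<cong>\<^sub>r H)"
    by (intro sympI) (auto intro: rgraph_iso_sym rooted_tree_rt)
  show "transp (\<lambda>G H :: nat rgraph. rooted_tree G \<and> rooted_tree H \<and> G \<cong>\<^sub>r H)"
    by (intro transpI conjI) (simp, simp, erule conjE, erule conjE, erule rgraph_iso_trans, simp)
qed

lemma rooted_tree_rep: "rooted_tree (rep_rtree t)"
  using Quotient3_rep_reflp[OF Quotient3_rtree] by blast

lemma rtree_eq_iff: "s = t \<longleftrightarrow> rep_rtree s \<cong>\<^sub>r rep_rtree t"
  using Quotient3_rel_rep[OF Quotient3_rtree, of s t] rooted_tree_rep by blast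

definition tsize :: "rtree \<Rightarrow> nat" where
  "tsize t = card (verts (rep_rtree t))"


subsection \<open>Cutting an edge and joining at a vertex\<close>

definition gdist :: "'v rgraph \<Rightarrow> 'v \<Rightarrow> 'v \<Rightarrow> nat" where
  "gdist G u v = (LEAST n. (u, v) \<in> adj (edges G) ^^ n)"

definition root_side :: "'v rgraph \<Rightarrow> 'v set \<Rightarrow> 'v set" where
  "root_side G e = {v \<in> verts G. (rt G, v) \<in> (adj (edges G - {e}))\<^sup>*}"

definition cut_R :: "'v rgraph \<Rightarrow> 'v set \<Rightarrow> 'v rgraph" where
  "cut_R G e = RGraph (root_side G e) {f \<in> edges G - {e}. f \<subseteq> root_side G e} (rt G)"

text \<open>In a rooted tree exactly one vertex of the cut-off part is closest to the root, so the choice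
  made by \<open>ARG_MIN\<close> below is forced.\<close>

definition cut_P :: "'v rgraph \<Rightarrow> 'v set \<Rightarrow> 'v rgraph" where
  "cut_P G e = (let W = verts G - root_side G e in
     RGraph W {f \<in> edges G - {e}. f \<subseteq> W} (ARG_MIN (gdist G (rt G)) w. w \<in> W))"

definition graft :: "'v rgraph \<Rightarrow> 'v \<Rightarrow> 'w rgraph \<Rightarrow> ('v + 'w) rgraph" where
  "graft G v H = RGraph (verts G <+> verts H)
     ((`) Inl ` edges G \<union> (`) Inr ` edges H \<union> {{Inl v, Inr (rt H)}}) (Inl (rt G))"

text \<open>Both counts are invariant under isomorphism, so they may be taken on representatives.\<close>

definition alpha :: "rtree \<Rightarrow> rtree \<Rightarrow> rtree \<Rightarrow> nat" where
  "alpha t1 t2 t3 = card {e \<in> edges (rep_rtree t2).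
     cut_R (rep_rtree t2) e \<cong>\<^sub>r rep_rtree t3 \<and> cut_P (rep_rtree t2) e \<cong>\<^sub>r rep_rtree t1}"

definition beta :: "rtree \<Rightarrow> rtree \<Rightarrow> rtree \<Rightarrow> nat" where
  "beta t1 t2 t3 = card {v \<in> verts (rep_rtree t3).
     rep_rtree t1 \<cong>\<^sub>r graft (rep_rtree t3) v (rep_rtree t2)}"

lemma rgraph_iso_card: "G \<cong>\<^sub>r H \<Longrightarrow> card (verts G) = card (verts H)"
  unfolding rgraph_iso_def using bij_betw_same_card by blast

lemma card_Collect_nonzero: "card {x \<in> A. P x} \<noteq> 0 \<Longrightarrow> \<exists>x\<in>A. P x"
  by (metis (mono_tags, lifting) card_eq_0_iff empty_Collect_eq)

lemma alpha_nonzero_size: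
  assumes "alpha t1 t2 t3 \<noteq> 0"
  shows "tsize t2 = tsize t1 + tsize t3"
proof -
  let ?G = "rep_rtree t2"
  from assms obtain e where e: "cut_R ?G e \<cong>\<^sub>r rep_rtree t3" "cut_P ?G e \<cong>\<^sub>r rep_rtree t1"
    using card_Collect_nonzero[OF assms[unfolded alpha_def]] by blast
  have "finite (verts ?G)"
    using rooted_tree_rep by (simp add: rooted_tree_def)
  moreover have "root_side ?G e \<subseteq> verts ?G"
    by (auto simp: root_side_def)
  ultimately have "card (verts ?G) = card (verts ?G - root_side ?G e) + card (root_side ?G e)"
    by (simp add: card_Diff_subset card_mono finite_subset)
  then show ?thesis
    using rgraph_iso_card[OF e(1)] rgraph_iso_card[OF e(2)]
    by (simp add: tsize_def cut_R_def cut_P_def Let_def)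
qed

lemma beta_nonzero_size:
  assumes "beta t1 t2 t3 \<noteq> 0"
  shows "tsize t1 = tsize t2 + tsize t3"
proof -
  from assms obtain v where v: "rep_rtree t1 \<cong>\<^sub>r graft (rep_rtree t3) v (rep_rtree t2)"
    using card_Collect_nonzero[OF assms[unfolded beta_def]] by blast
  have "finite (verts (rep_rtree t2))" "finite (verts (rep_rtree t3))"
    using rooted_tree_rep by (simp_all add: rooted_tree_def)
  then show ?thesis
    using rgraph_iso_card[OF v] by (simp add: tsize_def graft_def card_Plus)
qed

lemma finite_tsize: "finite {t. tsize t = n}"
proof -
  have "\<exists>H. verts H = {..<n} \<and> edges H \<subseteq> Pow {..<n} \<and> rt H < n \<and> rep_rtree t \<cong>\<^sub>r H"
    if sz: "tsize t = n" for t
  proof -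
    let ?G = "rep_rtree t"
    have T: "rooted_tree ?G"
      by (rule rooted_tree_rep)
    then have "finite (verts ?G)"
      by (simp add: rooted_tree_def)
    then obtain f where f: "bij_betw f (verts ?G) {..<n}"
      using ex_bij_betw_finite_nat[of "verts ?G"] sz by (auto simp: tsize_def atLeast0LessThan)
    have E: "A \<subseteq> verts ?G" if "A \<in> edges ?G" for A
      using T that by (auto simp: rooted_tree_def)
    let ?H = "RGraph {..<n} ((`) f ` edges ?G) (f (rt ?G))"
    have "{u, v} \<in> edges ?G \<longleftrightarrow> {f u, f v} \<in> (`) f ` edges ?G"
      if "u \<in> verts ?G" "v \<in> verts ?G" for u v
    proof
      assume "{f u, f v} \<in> (`) f ` edges ?G"
      then obtain A where A: "A \<in> edges ?G" "f ` A = f ` {u, v}"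
        by auto
      then have "A = {u, v}"
        using inj_on_image_eq_iff[OF bij_betw_imp_inj_on[OF f] E[OF A(1)], of "{u, v}"] that by auto
      then show "{u, v} \<in> edges ?G"
        using A by simp
    next
      assume "{u, v} \<in> edges ?G"
      then have "f ` {u, v} \<in> (`) f ` edges ?G"
        by (rule imageI)
      then show "{f u, f v} \<in> (`) f ` edges ?G"
        by simp
    qed
    then have "?G \<cong>\<^sub>r ?H"
      unfolding rgraph_iso_def using f by (intro exI[of _ f]) auto
    moreover have "f (rt ?G) < n"
      using bij_betwE[OF f] rooted_tree_rt[OF T] by simp
    moreover have "(`) f ` edges ?G \<subseteq> Pow {..<n}"
      using E f by (fastforce simp: bij_betw_def)
    ultimately show ?thesis
      by (intro exI[of _ ?H]) auto
  qed
  then obtain h where h: "\<And>t. tsize t = n \<Longrightarrow> verts (h t) = {..<n} \<and>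
      edges (h t) \<subseteq> Pow {..<n} \<and> rt (h t) < n \<and> rep_rtree t \<cong>\<^sub>r h t"
    by metis
  have "inj_on h {t. tsize t = n}"
  proof (rule inj_onI)
    fix s t assume *: "s \<in> {t. tsize t = n}" "t \<in> {t. tsize t = n}" "h s = h t"
    have "rep_rtree s \<cong>\<^sub>r h s" "rep_rtree t \<cong>\<^sub>r h s"
      using h[of s] h[of t] * by auto
    then show "s = t"
      unfolding rtree_eq_iff
      using rgraph_iso_sym[OF _ rooted_tree_rt[OF rooted_tree_rep]] rgraph_iso_trans by metis
  qed
  moreover have "h ` {t. tsize t = n} \<subseteq>
      (\<lambda>(E, r). RGraph {..<n} E r) ` (Pow (Pow {..<n}) \<times> {..<n})"
  proof
    fix H assume "H \<in> h ` {t. tsize t = n}"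
    then have "verts H = {..<n}" "edges H \<in> Pow (Pow {..<n})" "rt H < n"
      using h by auto
    then show "H \<in> (\<lambda>(E, r). RGraph {..<n} E r) ` (Pow (Pow {..<n}) \<times> {..<n})"
      by (intro image_eqI[of _ _ "(edges H, rt H)"]) (cases H; auto)+
  qed
  ultimately show ?thesis
    by (meson finite_Pow_iff finite_SigmaI finite_imageD finite_imageI finite_lessThan finite_subset)
qed

text \<open>The sums over all trees in the defining relations have finite support.\<close>

lemma finite_support:
  "finite {r. alpha s t r \<noteq> 0}" "finite {r. alpha s r t \<noteq> 0}"
  "finite {r. beta s t r \<noteq> 0}" "finite {r. beta r s t \<noteq> 0}"
proof -
  show "finite {r. alpha s t r \<noteq> 0}"
    by (rule finite_subset[OF _ finite_tsize[of "tsize t - tsize s"]])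
      (auto dest!: alpha_nonzero_size simp del: neq0_conv)
  show "finite {r. alpha s r t \<noteq> 0}"
    by (rule finite_subset[OF _ finite_tsize[of "tsize s + tsize t"]])
      (auto dest!: alpha_nonzero_size simp del: neq0_conv)
  show "finite {r. beta s t r \<noteq> 0}"
    by (rule finite_subset[OF _ finite_tsize[of "tsize s - tsize t"]])
      (auto dest!: beta_nonzero_size simp del: neq0_conv)
  show "finite {r. beta r s t \<noteq> 0}"
    by (rule finite_subset[OF _ finite_tsize[of "tsize s + tsize t"]])
      (auto dest!: beta_nonzero_size simp del: neq0_conv)
qed


section \<open>The insertion-elimination algebra\<close>

datatype gen = GD | GPlus rtree | GMinus rtree

text \<open>The complex vector space with basis \<open>gen\<close>: finitely supported coefficient functions.\<close>

type_synonym ie = "gen \<Rightarrow>\<^sub>0 complex"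

definition sc :: "complex \<Rightarrow> ie \<Rightarrow> ie" (infixr \<open>*\<^sub>g\<close> 75) where
  "c *\<^sub>g x = Poly_Mapping.map ((*) c) x"

lemma lookup_sc [simp]: "Poly_Mapping.lookup (c *\<^sub>g x) k = c * Poly_Mapping.lookup x k"
  by (simp add: sc_def Poly_Mapping.map.rep_eq when_def)

lemma vector_space_ie: "vector_space (*\<^sub>g)"
  by unfold_locales (auto intro!: poly_mapping_eqI simp: lookup_add algebra_simps)

definition Dd :: ie where "Dd = Poly_Mapping.single GD 1"
definition Dp :: "rtree \<Rightarrow> ie" where "Dp t = Poly_Mapping.single (GPlus t) 1"
definition Dm :: "rtree \<Rightarrow> ie" where "Dm t = Poly_Mapping.single (GMinus t) 1"

definition mixed :: "rtree \<Rightarrow> rtree \<Rightarrow> ie" where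
  "mixed s t = (if s = t then Dd
     else Sum_any (\<lambda>r. of_nat (alpha s t r) *\<^sub>g Dp r) + Sum_any (\<lambda>r. of_nat (beta s t r) *\<^sub>g Dm r))"

text \<open>Beyond the defining relations this only adds the mirrored cases forced by antisymmetry.\<close>

fun gen_bracket :: "gen \<Rightarrow> gen \<Rightarrow> ie" where
  "gen_bracket (GPlus s) (GPlus t) =
     Sum_any (\<lambda>r. (of_nat (beta r s t) - of_nat (beta r t s)) *\<^sub>g Dp r)"
| "gen_bracket (GMinus s) (GMinus t) =
     Sum_any (\<lambda>r. (of_nat (alpha t r s) - of_nat (alpha s r t)) *\<^sub>g Dm r)"
| "gen_bracket (GMinus s) (GPlus t) = mixed s t"
| "gen_bracket (GPlus t) (GMinus s) = - mixed s t"
| "gen_bracket GD (GMinus t) = - of_nat (tsize t) *\<^sub>g Dm t"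
| "gen_bracket (GMinus t) GD = of_nat (tsize t) *\<^sub>g Dm t"
| "gen_bracket GD (GPlus t) = of_nat (tsize t) *\<^sub>g Dp t"
| "gen_bracket (GPlus t) GD = - of_nat (tsize t) *\<^sub>g Dp t"
| "gen_bracket GD GD = 0"

definition bracket :: "ie \<Rightarrow> ie \<Rightarrow> ie" where
  "bracket x y = (\<Sum>a\<in>Poly_Mapping.keys x. \<Sum>b\<in>Poly_Mapping.keys y.
     (Poly_Mapping.lookup x a * Poly_Mapping.lookup y b) *\<^sub>g gen_bracket a b)"

lemma bracket_single:
  "bracket (Poly_Mapping.single a 1) (Poly_Mapping.single b 1) = gen_bracket a b"
  by (auto intro!: poly_mapping_eqI simp: bracket_def)

lemma bracket_relations:
  "bracket (Dp s) (Dp t) = Sum_any (\<lambda>r. (of_nat (beta r s t) - of_nat (beta r t s)) *\<^sub>g Dp r)"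
  "bracket (Dm s) (Dm t) = Sum_any (\<lambda>r. (of_nat (alpha t r s) - of_nat (alpha s r t)) *\<^sub>g Dm r)"
  "s \<noteq> t \<Longrightarrow> bracket (Dm s) (Dp t) =
     Sum_any (\<lambda>r. of_nat (alpha s t r) *\<^sub>g Dp r) + Sum_any (\<lambda>r. of_nat (beta s t r) *\<^sub>g Dm r)"
  "bracket (Dm t) (Dp t) = Dd"
  "bracket Dd (Dm t) = - of_nat (tsize t) *\<^sub>g Dm t"
  "bracket Dd (Dp t) = of_nat (tsize t) *\<^sub>g Dp t"
  by (simp_all add: Dd_def Dp_def Dm_def bracket_single mixed_def)

lemma bracket_superset:
  assumes "finite A" "finite B" "Poly_Mapping.keys x \<subseteq> A" "Poly_Mapping.keys y \<subseteq> B"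
  shows "bracket x y = (\<Sum>a\<in>A. \<Sum>b\<in>B. (Poly_Mapping.lookup x a * Poly_Mapping.lookup y b) *\<^sub>g gen_bracket a b)"
proof -
  have z: "0 *\<^sub>g u = 0" for u
    by (rule poly_mapping_eqI) simp
  have "bracket x y = (\<Sum>a\<in>A. \<Sum>b\<in>Poly_Mapping.keys y. (Poly_Mapping.lookup x a * Poly_Mapping.lookup y b) *\<^sub>g gen_bracket a b)"
    unfolding bracket_def using assms
    by (intro sum.mono_neutral_left) (auto simp: in_keys_iff z)
  also have "\<dots> = (\<Sum>a\<in>A. \<Sum>b\<in>B. (Poly_Mapping.lookup x a * Poly_Mapping.lookup y b) *\<^sub>g gen_bracket a b)"
    using assms by (intro sum.cong refl sum.mono_neutral_left) (auto simp: in_keys_iff z)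
  finally show ?thesis .
qed

lemma bracket_bilinear:
  "Vector_Spaces.linear (*\<^sub>g) (*\<^sub>g) (bracket x)"
  "Vector_Spaces.linear (*\<^sub>g) (*\<^sub>g) (\<lambda>x. bracket x y)"
proof -
  interpret vector_space "(*\<^sub>g)" by (rule vector_space_ie)
  have sub: "Poly_Mapping.keys (c *\<^sub>g u) \<subseteq> Poly_Mapping.keys u" for c u
    by (auto simp: in_keys_iff)
  have "bracket x (y + z) = bracket x y + bracket x z" for y z
    by (subst (1 2 3) bracket_superset[where A = "Poly_Mapping.keys x"
          and B = "Poly_Mapping.keys y \<union> Poly_Mapping.keys z"])
      (auto simp: lookup_add distrib_left scale_left_distrib sum.distrib dest: subsetD[OF Poly_Mapping.keys_add])
  moreover have "bracket x (c *\<^sub>g y) = c *\<^sub>g bracket x y" for c y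
    by (subst (1 2) bracket_superset[where A = "Poly_Mapping.keys x" and B = "Poly_Mapping.keys y"])
      (use sub in \<open>auto simp: scale_sum_right mult_ac intro!: sum.cong\<close>)
  ultimately show "Vector_Spaces.linear (*\<^sub>g) (*\<^sub>g) (bracket x)"
    using vector_space_ie by (simp add: Vector_Spaces.linear_iff)
  have "bracket (x + z) y = bracket x y + bracket z y" for x z
    by (subst (1 2 3) bracket_superset[where B = "Poly_Mapping.keys y"
          and A = "Poly_Mapping.keys x \<union> Poly_Mapping.keys z"])
      (auto simp: lookup_add distrib_right scale_left_distrib sum.distrib dest: subsetD[OF Poly_Mapping.keys_add])
  moreover have "bracket (c *\<^sub>g x) y = c *\<^sub>g bracket x y" for c x
    by (subst (1 2) bracket_superset[where A = "Poly_Mapping.keys x" and B = "Poly_Mapping.keys y"])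
      (use sub in \<open>auto simp: scale_sum_right mult_ac intro!: sum.cong\<close>)
  ultimately show "Vector_Spaces.linear (*\<^sub>g) (*\<^sub>g) (\<lambda>x. bracket x y)"
    using vector_space_ie by (simp add: Vector_Spaces.linear_iff)
qed


section \<open>The automorphism group\<close>

definition is_ie_aut :: "(ie \<Rightarrow> ie) \<Rightarrow> bool" where
  "is_ie_aut f \<longleftrightarrow> Vector_Spaces.linear (*\<^sub>g) (*\<^sub>g) f \<and> bij f \<and>
     (\<forall>x y. f (bracket x y) = bracket (f x) (f y))"

definition Aut_ie :: "(ie \<Rightarrow> ie) monoid" where
  "Aut_ie = \<lparr>carrier = {f. is_ie_aut f}, mult = (\<circ>), one = id\<rparr>"

lemma group_Aut_ie: "group Aut_ie"
proof (rule groupI)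
  fix f g assume "f \<in> carrier Aut_ie" "g \<in> carrier Aut_ie"
  then show "f \<otimes>\<^bsub>Aut_ie\<^esub> g \<in> carrier Aut_ie"
    by (auto simp: Aut_ie_def is_ie_aut_def bij_comp Vector_Spaces.linear_compose)
next
  show "\<one>\<^bsub>Aut_ie\<^esub> \<in> carrier Aut_ie"
    by (simp add: Aut_ie_def is_ie_aut_def Vector_Spaces.linear_iff vector_space_ie)
next
  fix f assume "f \<in> carrier Aut_ie"
  then have f: "Vector_Spaces.linear (*\<^sub>g) (*\<^sub>g) f" "bij f"
      "\<And>x y. f (bracket x y) = bracket (f x) (f y)"
    by (auto simp: Aut_ie_def is_ie_aut_def)
  have i: "inv_into UNIV f (f x) = x" "f (inv_into UNIV f x) = x" for x
    using f(2) by (simp_all add: bij_is_inj bij_is_surj surj_f_inv_f)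
  have "is_ie_aut (inv_into UNIV f)"
    unfolding is_ie_aut_def
  proof (intro conjI allI)
    show "Vector_Spaces.linear (*\<^sub>g) (*\<^sub>g) (inv_into UNIV f)"
      using f(1) i unfolding Vector_Spaces.linear_iff by metis
    show "bij (inv_into UNIV f)"
      using f(2) by (rule bij_imp_bij_inv)
    show "inv_into UNIV f (bracket x y) = bracket (inv_into UNIV f x) (inv_into UNIV f y)" for x y
      using f(3) i by metis
  qed
  moreover have "inv_into UNIV f \<circ> f = id"
    using i by auto
  ultimately show "\<exists>g\<in>carrier Aut_ie. g \<otimes>\<^bsub>Aut_ie\<^esub> f = \<one>\<^bsub>Aut_ie\<^esub>"
    by (auto simp: Aut_ie_def)
qed (auto simp: Aut_ie_def comp_assoc)

definition group_center :: "('a, 'b) monoid_scheme \<Rightarrow> 'a set" where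
  "group_center G = {z \<in> carrier G. \<forall>x\<in>carrier G. z \<otimes>\<^bsub>G\<^esub> x = x \<otimes>\<^bsub>G\<^esub> z}"

primrec tau_weight :: "gen \<Rightarrow> complex" where
  "tau_weight GD = 1"
| "tau_weight (GPlus t) = (-1) ^ tsize t"
| "tau_weight (GMinus t) = (-1) powi (- int (tsize t))"

text \<open>The linear extension of the prescribed values on the basis.\<close>

definition tau_minus_one :: "ie \<Rightarrow> ie" where
  "tau_minus_one x = (\<Sum>k\<in>Poly_Mapping.keys x.
     (Poly_Mapping.lookup x k * tau_weight k) *\<^sub>g Poly_Mapping.single k 1)"

lemma tau_minus_one_basis:
  "tau_minus_one Dd = Dd"
  "tau_minus_one (Dp t) = (-1) ^ tsize t *\<^sub>g Dp t"
  "tau_minus_one (Dm t) = (-1) powi (- int (tsize t)) *\<^sub>g Dm t"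
  by (auto intro!: poly_mapping_eqI simp: tau_minus_one_def Dd_def Dp_def Dm_def)

lemma lookup_tau_minus_one: "Poly_Mapping.lookup (tau_minus_one x) k = tau_weight k * Poly_Mapping.lookup x k"
  by (auto simp: tau_minus_one_def lookup_sum lookup_single when_def sum.delta' in_keys_iff
      if_distrib[of "\<lambda>z. _ * z"] cong: if_cong)

lemma linear_tau_minus_one: "Vector_Spaces.linear (*\<^sub>g) (*\<^sub>g) tau_minus_one"
  unfolding Vector_Spaces.linear_iff
  by (auto intro!: poly_mapping_eqI simp: vector_space_ie lookup_tau_minus_one lookup_add algebra_simps)

end

theory Submission
  imports Defs
begin

text \<open>
  Give \<open>D\<^sub>t\<^sup>+\<close> the degree \<open>|t|\<close>, \<open>D\<^sub>t\<^sup>-\<close> the degree \<open>-|t|\<close> and \<open>d\<close> the degree \<open>0\<close>. Two kinds of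
  automorphisms are explicit. The grading gives \<open>tau c\<close>, which multiplies elements of degree \<open>n\<close>
  by \<open>c\<^sup>n\<close> for \<open>c \<noteq> 0\<close>; \<open>tau (-1)\<close> is \<open>tau_minus_one\<close>. The other one, \<open>omega\<close>, exchanges \<open>D\<^sub>t\<^sup>+\<close> and \<open>D\<^sub>t\<^sup>-\<close> up to
  scalars and negates \<open>d\<close>. It respects the bracket because of the identity
  \<open>beta r s t * sigma r = alpha s r t * sigma s * sigma t\<close> (\<open>beta_sigma\<close>), where \<open>sigma t\<close> is the
  number of automorphisms of \<open>t\<close>: an isomorphism from \<open>t\<close> with \<open>s\<close> grafted on it to \<open>r\<close> is the same
  thing as an edge of \<open>r\<close> together with isomorphisms from \<open>t\<close> and \<open>s\<close> to the two pieces that are left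
  after cutting it.

  The automorphism \<open>tau_minus_one\<close> is central because every automorphism \<open>f\<close> sends \<open>d\<close> to \<open>d\<close> or
  \<open>-d\<close>, hence elements of degree \<open>n\<close> to elements of degree \<open>n\<close> or \<open>-n\<close>, and both have the same parity.
  Indeed \<open>d\<close> acts locally finitely, and so does \<open>x = f d\<close>. Suppose some \<open>D\<^sub>t\<^sup>+\<close> occurs in \<open>x\<close>; take
  \<open>t0\<close> of maximal size among such trees, and let \<open>u\<^sub>k\<close> be the root carrying \<open>k\<close> copies of \<open>t0\<close>. In the
  bracket of \<open>x\<close> with \<open>D\<^sup>+\<close> of a tree with many root branches, the terms of highest degree and, among
  those, of highest number of root branches arise by attaching a tree of \<open>x\<close> to the root. This is
  multiplication in a polynomial ring whose variables are the trees, so powers of \<open>t0\<close> do not cancel: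
  repeated brackets with \<open>x\<close> produce \<open>u\<^sub>k\<close> for ever larger \<open>k\<close>, contradicting local finiteness
  (\<open>not_locally_finite\<close>). Applied to \<open>omega \<circ> f\<close>, the argument excludes the \<open>D\<^sub>t\<^sup>-\<close> as well. Hence
  \<open>f d = c d\<close>, and comparing eigenvalues for \<open>f\<close> and its inverse, \<open>c\<close> and \<open>1 / c\<close> are integers.

  Conversely, a central \<open>f\<close> commutes with \<open>tau 2\<close>, so it preserves degrees, and with \<open>omega\<close>. It
  therefore scales \<open>D\<^sup>+\<close> and \<open>D\<^sup>-\<close> of the one-vertex tree by the same \<open>a\<close>, and \<open>d\<close>, their bracket, by
  \<open>a\<^sup>2\<close>; preservation of degrees forces \<open>a\<^sup>2 = 1\<close>. After composing with \<open>tau_minus_one\<close> if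
  necessary, \<open>a = 1\<close>, and then \<open>f\<close> is the identity by induction on the degree: the
  difference \<open>y = f D\<^sub>t\<^sup>- - D\<^sub>t\<^sup>-\<close> is killed by all \<open>D\<^sub>s\<^sup>+\<close> with \<open>|s| < |t|\<close>, and such a \<open>y\<close> vanishes, because
  grafting generates all trees from the one-vertex tree (\<open>minus_part_detected\<close>). Commutation with
  \<open>omega\<close> passes the result on to \<open>D\<^sub>t\<^sup>+\<close>.
\<close>

section \<open>Isomorphisms and walks in rooted graphs\<close>

text \<open>The witness in the definition of the relation \<open>\<cong>\<^sub>r\<close>, made explicit because isomorphisms are counted below.\<close>

definition is_iso :: "('v \<Rightarrow> 'w) \<Rightarrow> 'v rgraph \<Rightarrow> 'w rgraph \<Rightarrow> bool" where
  "is_iso \<phi> G H \<longleftrightarrow> bij_betw \<phi> (verts G) (verts H) \<and> \<phi> (rt G) = rt H \<and>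
     (\<forall>u\<in>verts G. \<forall>v\<in>verts G. {u, v} \<in> edges G \<longleftrightarrow> {\<phi> u, \<phi> v} \<in> edges H)"

lemma rgraph_iso_iff: "G \<cong>\<^sub>r H \<longleftrightarrow> (\<exists>\<phi>. is_iso \<phi> G H)"
  by (simp add: rgraph_iso_def is_iso_def)

lemma is_iso_cong:
  assumes "is_iso \<phi> G H" "\<And>x. x \<in> verts G \<Longrightarrow> \<phi> x = \<psi> x" "rt G \<in> verts G"
  shows "is_iso \<psi> G H"
  using assms unfolding is_iso_def by (metis bij_betw_cong)

lemma is_iso_comp: "is_iso \<phi> G H \<Longrightarrow> is_iso \<psi> H K \<Longrightarrow> is_iso (\<psi> \<circ> \<phi>) G K"
  unfolding is_iso_def by (auto intro: bij_betw_trans simp: bij_betwE)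

definition loopfree :: "'v rgraph \<Rightarrow> bool" where
  "loopfree G \<longleftrightarrow> edges G \<subseteq> {{u, v} | u v. u \<in> verts G \<and> v \<in> verts G \<and> u \<noteq> v}"

lemma loopfreeD: "loopfree G \<Longrightarrow> {u, v} \<in> edges G \<Longrightarrow> u \<in> verts G \<and> v \<in> verts G \<and> u \<noteq> v"
  unfolding loopfree_def by (auto simp: doubleton_eq_iff dest!: subsetD)

lemma loopfreeE:
  assumes "loopfree G" "f \<in> edges G"
  obtains u v where "f = {u, v}" "u \<in> verts G" "v \<in> verts G" "u \<noteq> v"
  using assms unfolding loopfree_def by blast

lemma rooted_tree_altdef: "rooted_tree G \<longleftrightarrow>
  finite (verts G) \<and> rt G \<in> verts G \<and> loopfree G \<and> connected_graph G \<and> (\<nexists>p. is_cycle G p)"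
  by (simp add: rooted_tree_def loopfree_def)

lemma adj_iff: "(x, y) \<in> adj E \<longleftrightarrow> {x, y} \<in> E"
  by (simp add: adj_def)

lemma adj_rtrancl_sym: "(x, y) \<in> (adj E)\<^sup>* \<Longrightarrow> (y, x) \<in> (adj E)\<^sup>*"
  by (rule symD[OF sym_rtrancl]) (auto simp: sym_def adj_def insert_commute)

lemma rtrancl_image:
  assumes "(x, y) \<in> r\<^sup>*" "\<And>x y. (x, y) \<in> r \<Longrightarrow> (f x, f y) \<in> s"
  shows "(f x, f y) \<in> s\<^sup>*"
  using assms(1) by induct (auto intro: rtrancl.rtrancl_into_rtrancl assms(2))

lemma connected_graph_from_root:
  assumes "\<And>v. v \<in> verts G \<Longrightarrow> (c, v) \<in> (adj (edges G))\<^sup>*"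
  shows "connected_graph G"
  unfolding connected_graph_def by (meson assms adj_rtrancl_sym rtrancl_trans)

section \<open>Cutting a tree at an edge\<close>

text \<open>Removing the edge \<open>{a, b}\<close> leaves the side \<open>A\<close> of the root, ending in \<open>a\<close>, and the side \<open>W\<close>, beginning
  in \<open>b\<close>. Once this is verified for some guess of the four parameters, both cut-off trees are known.\<close>

definition cuts :: "'v rgraph \<Rightarrow> 'v set \<Rightarrow> 'v set \<Rightarrow> 'v \<Rightarrow> 'v \<Rightarrow> bool" where
  "cuts G A W a b \<longleftrightarrow> verts G = A \<union> W \<and> A \<inter> W = {} \<and> rt G \<in> A \<and> a \<in> A \<and> b \<in> W \<and> {a, b} \<in> edges G \<and>
     (\<forall>f\<in>edges G - {{a, b}}. f \<subseteq> A \<or> f \<subseteq> W) \<and>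
     (\<forall>x\<in>A. (rt G, x) \<in> (adj (edges G - {{a, b}}))\<^sup>*)"

lemma cuts_edge:
  assumes "cuts G A W a b" "{x, y} \<in> edges G" "{x, y} \<noteq> {a, b}"
  shows "x \<in> A \<and> y \<in> A \<or> x \<in> W \<and> y \<in> W"
proof -
  have "\<forall>f\<in>edges G - {{a, b}}. f \<subseteq> A \<or> f \<subseteq> W"
    using assms(1) by (simp add: cuts_def)
  then have "{x, y} \<subseteq> A \<or> {x, y} \<subseteq> W"
    using assms(2,3) by (meson DiffI singletonD)
  then show ?thesis by simp
qed

lemma cuts_root_side:
  assumes "cuts G A W a b"
  shows "root_side G {a, b} = A"
proof -
  have "x \<in> A" if "(rt G, x) \<in> (adj (edges G - {{a, b}}))\<^sup>*" for x
    using that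
  proof induct
    case base
    then show ?case using assms by (simp add: cuts_def)
  next
    case (step x y)
    then have "x \<in> A \<and> y \<in> A \<or> x \<in> W \<and> y \<in> W"
      by (intro cuts_edge[OF assms]) (auto simp: adj_iff)
    then show ?case using step assms by (auto simp: cuts_def)
  qed
  then show ?thesis
    using assms by (auto simp: root_side_def cuts_def)
qed

lemma cuts_cross:
  assumes "cuts G A W a b" "x \<in> A" "y \<in> W" "{x, y} \<in> edges G"
  shows "x = a" "y = b"
proof -
  have disj: "A \<inter> W = {}" and ab: "a \<in> A" "b \<in> W"
    using assms(1) by (auto simp: cuts_def)
  then have "{x, y} = {a, b}"
    using cuts_edge[OF assms(1,4)] assms(2,3) by blast
  then show "x = a" "y = b"
    using assms(2,3) disj ab by (auto simp: doubleton_eq_iff)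
qed

text \<open>A walk from the root into \<open>W\<close> must pass through \<open>b\<close> first, so every other vertex of \<open>W\<close> is strictly
  farther from the root.\<close>

lemma cuts_closest:
  assumes c: "cuts G A W a b" and conn: "connected_graph G"
  shows "(ARG_MIN (gdist G (rt G)) w. w \<in> W) = b"
proof -
  \<comment> \<open>\<open>b\<close> is reached on the way, and with equally many steps only if the walk ends there\<close>
  have walk: "\<exists>m\<le>n. (rt G, b) \<in> adj (edges G) ^^ m \<and> (m = n \<longrightarrow> w = b)"
    if "(rt G, w) \<in> adj (edges G) ^^ n" "w \<in> W" for n w
    using that
  proof (induct n arbitrary: w)
    case 0
    then show ?case using c by (auto simp: cuts_def)
  next
    case (Suc n)
    then obtain x where x: "(rt G, x) \<in> adj (edges G) ^^ n" "(x, w) \<in> adj (edges G)"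
      by auto
    have xw: "{x, w} \<in> edges G" using x(2) by (simp add: adj_iff)
    have ab: "a \<in> A" "b \<in> W" using c by (auto simp: cuts_def)
    have loc: "x \<in> A \<or> x \<in> W"
      using cuts_edge[OF c xw] ab by (cases "{x, w} = {a, b}") (auto simp: doubleton_eq_iff)
    show ?case
    proof (cases "x \<in> W")
      case True
      then show ?thesis using Suc(1)[OF x(1)] by (metis Suc_n_not_le_n le_SucI)
    next
      case False
      then have "w = b"
        using cuts_cross(2)[OF c _ Suc(3) xw] loc by simp
      then show ?thesis using Suc(2) by blast
    qed
  qed
  have rv: "rt G \<in> verts G" "W \<subseteq> verts G"
    using c by (auto simp: cuts_def)
  then have reach: "(rt G, w) \<in> adj (edges G) ^^ gdist G (rt G) w" if "w \<in> W" for w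
  proof -
    have "(rt G, w) \<in> (adj (edges G))\<^sup>*"
      using conn that rv by (auto simp: connected_graph_def)
    then obtain n where "(rt G, w) \<in> adj (edges G) ^^ n"
      using rtrancl_imp_relpow by blast
    then show ?thesis unfolding gdist_def by (rule LeastI)
  qed
  have strict: "gdist G (rt G) b < gdist G (rt G) w" if w: "w \<in> W" "w \<noteq> b" for w
  proof -
    obtain m where m: "m \<le> gdist G (rt G) w" "(rt G, b) \<in> adj (edges G) ^^ m"
      "m = gdist G (rt G) w \<longrightarrow> w = b"
      using walk[OF reach[OF w(1)] w(1)] by blast
    have "gdist G (rt G) b \<le> m"
      unfolding gdist_def using m(2) by (rule Least_le)
    then show ?thesis using m w by linarith
  qed
  have b: "b \<in> W" using c by (simp add: cuts_def)
  let ?m = "ARG_MIN (gdist G (rt G)) w. w \<in> W"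
  have "?m \<in> W" "\<And>w. w \<in> W \<Longrightarrow> gdist G (rt G) ?m \<le> gdist G (rt G) w"
    using arg_min_nat_lemma[of "\<lambda>w. w \<in> W" b "gdist G (rt G)"] b by auto
  then show ?thesis using strict[of ?m] b by (metis leD)
qed

lemma cut_R_eq: "cuts G A W a b \<Longrightarrow>
    cut_R G {a, b} = RGraph A {f \<in> edges G - {{a, b}}. f \<subseteq> A} (rt G)"
  by (simp add: cut_R_def cuts_root_side)

lemma cut_P_eq: "cuts G A W a b \<Longrightarrow> connected_graph G \<Longrightarrow>
    cut_P G {a, b} = RGraph W {f \<in> edges G - {{a, b}}. f \<subseteq> W} b"
proof -
  assume c: "cuts G A W a b" "connected_graph G"
  have "verts G - A = W" using c by (auto simp: cuts_def)
  then show ?thesis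
    using cuts_closest[OF c] by (simp add: cut_P_def cuts_root_side[OF c(1)] Let_def)
qed

lemma walk_distinct:
  assumes "(x, y) \<in> (adj F)\<^sup>*"
  shows "\<exists>p. p \<noteq> [] \<and> distinct p \<and> hd p = x \<and> last p = y \<and> successively (\<lambda>u v. {u, v} \<in> F) p"
  using assms
proof induct
  case base
  show ?case by (rule exI[of _ "[x]"]) simp
next
  case (step y z)
  then obtain p where p: "p \<noteq> []" "distinct p" "hd p = x" "last p = y"
    "successively (\<lambda>u v. {u, v} \<in> F) p" by blast
  show ?case
  proof (cases "z \<in> set p")
    case True
    then obtain q r where "p = q @ z # r" by (meson split_list)
    then show ?thesis
      using p by (intro exI[of _ "q @ [z]"]) (auto simp: successively_append_iff hd_append)
  next
    case False
    then show ?thesis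
      using p step(2) by (intro exI[of _ "p @ [z]"]) (auto simp: successively_append_iff adj_iff)
  qed
qed

text \<open>Every edge of a tree is a bridge: if both ends remained connected with the root after removing it,
  a path between them would close to a cycle; if neither did, no walk from the root could ever use the
  edge, and its ends would not be connected with the root in the whole tree either.\<close>

lemma tree_edge_cuts:
  assumes T: "rooted_tree G" and e: "e \<in> edges G"
  obtains a b where "e = {a, b}" "cuts G (root_side G e) (verts G - root_side G e) a b"
proof -
  have lf: "loopfree G" and conn: "connected_graph G" and rtv: "rt G \<in> verts G"
    and acyc: "\<nexists>p. is_cycle G p"
    using T by (auto simp: rooted_tree_altdef)
  let ?A = "root_side G e" and ?F = "edges G - {e}"
  obtain u v where uv: "e = {u, v}" "u \<in> verts G" "v \<in> verts G" "u \<noteq> v"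
    using loopfreeE[OF lf e] by metis
  have side: "y \<in> ?A" if "x \<in> ?A" "{x, y} \<in> ?F" for x y
    using that loopfreeD[OF lf, of x y] unfolding root_side_def
    by (auto simp: adj_iff intro: rtrancl.rtrancl_into_rtrancl)
  have "\<not> (u \<in> ?A \<and> v \<in> ?A)"
  proof
    assume "u \<in> ?A \<and> v \<in> ?A"
    then have "(rt G, u) \<in> (adj ?F)\<^sup>*" "(rt G, v) \<in> (adj ?F)\<^sup>*"
      by (auto simp: root_side_def)
    then have "(u, v) \<in> (adj ?F)\<^sup>*"
      by (metis adj_rtrancl_sym rtrancl_trans)
    then obtain p where p: "p \<noteq> []" "distinct p" "hd p = u" "last p = v"
      "successively (\<lambda>u v. {u, v} \<in> ?F) p" using walk_distinct by metis
    have "length p \<noteq> 1" "length p \<noteq> 2"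
      using p uv by (auto simp: length_Suc_conv numeral_2_eq_2)
    then have len: "length p \<ge> 3"
      using p(1) by (metis One_nat_def Suc_leI le_neq_implies_less length_greater_0_conv numeral_2_eq_2 numeral_3_eq_3)
    have nth: "{p ! i, p ! Suc i} \<in> edges G" if "Suc i < length p" for i
      using p(5) that by (auto simp: successively_conv_nth)
    have "p ! i \<in> verts G" if "i < length p" for i
    proof (cases "Suc i < length p")
      case True
      then show ?thesis using nth[OF True] loopfreeD[OF lf] by blast
    next
      case False
      then have "Suc (i - 1) < length p" "i = Suc (i - 1)"
        using that len by auto
      then show ?thesis using nth[of "i - 1"] loopfreeD[OF lf] by metis
    qed
    then have "set p \<subseteq> verts G" by (auto simp: in_set_conv_nth)
    then have "is_cycle G p"
      unfolding is_cycle_def using len p nth e uv by (auto simp: insert_commute)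
    then show False using acyc by blast
  qed
  moreover have "u \<in> ?A \<or> v \<in> ?A"
  proof (rule ccontr)
    assume n: "\<not> (u \<in> ?A \<or> v \<in> ?A)"
    have "x \<in> ?A" if "(rt G, x) \<in> (adj (edges G))\<^sup>*" for x
      using that
    proof induct
      case base
      then show ?case using rtv by (simp add: root_side_def)
    next
      case (step x y)
      then have "{x, y} \<noteq> e" using n uv by (auto simp: doubleton_eq_iff)
      then show ?case using step side by (auto simp: adj_iff)
    qed
    moreover have "(rt G, u) \<in> (adj (edges G))\<^sup>*"
      using uv(2) conn rtv by (simp add: connected_graph_def)
    ultimately show False using n by blast
  qed
  ultimately obtain a b where ab: "e = {a, b}" "a \<in> ?A" "b \<in> verts G - ?A"
    using uv by (metis DiffI insert_commute)
  have "f \<subseteq> ?A \<or> f \<subseteq> verts G - ?A" if f: "f \<in> ?F" for f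
  proof -
    obtain x y where xy: "f = {x, y}" "x \<in> verts G" "y \<in> verts G"
      using loopfreeE[OF lf] f by (metis DiffD1)
    then show ?thesis using side[of x y] side[of y x] f by (auto simp: insert_commute)
  qed
  then have "cuts G ?A (verts G - ?A) a b"
    unfolding cuts_def using ab e rtv by (auto simp: root_side_def)
  then show thesis using that ab by blast
qed

text \<open>Connectedness of the lower part: a step of a walk from the root that enters \<open>W\<close> ends in \<open>b\<close>, so what
  follows the last such step is a walk from \<open>b\<close> inside \<open>W\<close>.\<close>

lemma cuts_rooted_tree:
  assumes T: "rooted_tree G" and c: "cuts G A W a b"
  shows "rooted_tree (RGraph A {f \<in> edges G - {{a, b}}. f \<subseteq> A} (rt G))"
    and "rooted_tree (RGraph W {f \<in> edges G - {{a, b}}. f \<subseteq> W} b)"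
proof -
  have lf: "loopfree G" and conn: "connected_graph G" and fin: "finite (verts G)"
    and acyc: "\<nexists>p. is_cycle G p"
    using T by (auto simp: rooted_tree_altdef)
  have sub: "A \<subseteq> verts G" "W \<subseteq> verts G" "rt G \<in> A" "b \<in> W"
    using c by (auto simp: cuts_def)
  let ?E = "\<lambda>B. {f \<in> edges G - {{a, b}}. f \<subseteq> B}"
  have lf': "loopfree (RGraph B (?E B) r)" for B r
    unfolding loopfree_def by (auto elim!: loopfreeE[OF lf])
  have cyc: "\<nexists>p. is_cycle (RGraph B (?E B) r) p" if "B \<subseteq> verts G" for B r
  proof
    assume "\<exists>p. is_cycle (RGraph B (?E B) r) p"
    then obtain p where "is_cycle (RGraph B (?E B) r) p" ..
    then have "is_cycle G p" using that unfolding is_cycle_def by (simp, meson order_trans)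
    then show False using acyc by blast
  qed
  have "(rt G, x) \<in> (adj (?E A))\<^sup>* \<and> x \<in> A" if "(rt G, x) \<in> (adj (edges G - {{a, b}}))\<^sup>*" for x
    using that
  proof induct
    case base
    then show ?case using sub by simp
  next
    case (step x y)
    then have "x \<in> A \<and> y \<in> A \<or> x \<in> W \<and> y \<in> W"
      by (intro cuts_edge[OF c]) (auto simp: adj_iff)
    then have "{x, y} \<subseteq> A"
      using step(3) c by (auto simp: cuts_def)
    then have "(x, y) \<in> adj (?E A)"
      using step(2) by (simp add: adj_iff)
    then show ?case using step \<open>{x, y} \<subseteq> A\<close> by (auto intro: rtrancl.rtrancl_into_rtrancl)
  qed
  then have "connected_graph (RGraph A (?E A) (rt G))"
    using c by (intro connected_graph_from_root[where c = "rt G"]) (auto simp: cuts_def)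
  then show "rooted_tree (RGraph A (?E A) (rt G))"
    using sub fin finite_subset lf' cyc by (auto simp: rooted_tree_altdef)
  have "x \<in> W \<longrightarrow> (b, x) \<in> (adj (?E W))\<^sup>*" if "(rt G, x) \<in> (adj (edges G))\<^sup>*" for x
    using that
  proof induct
    case base
    then show ?case using c by (auto simp: cuts_def)
  next
    case (step x y)
    show ?case
    proof
      assume y: "y \<in> W"
      have e: "{x, y} \<in> edges G" using step by (simp add: adj_iff)
      then have "x \<in> A \<or> x \<in> W"
        using loopfreeD[OF lf e] c by (auto simp: cuts_def)
      then show "(b, y) \<in> (adj (?E W))\<^sup>*"
      proof
        assume "x \<in> A"
        then show ?thesis using cuts_cross[OF c _ y e] by simp
      next
        assume x: "x \<in> W"
        then have "{x, y} \<noteq> {a, b}" using c y by (auto simp: cuts_def)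
        then have "(x, y) \<in> adj (?E W)"
          using e x y by (simp add: adj_iff)
        then show ?thesis using step x by (auto intro: rtrancl.rtrancl_into_rtrancl)
      qed
    qed
  qed
  moreover have "(rt G, x) \<in> (adj (edges G))\<^sup>*" if "x \<in> W" for x
    using conn sub that by (auto simp: connected_graph_def)
  ultimately have "connected_graph (RGraph W (?E W) b)"
    by (intro connected_graph_from_root[where c = b]) simp
  then show "rooted_tree (RGraph W (?E W) b)"
    using sub fin finite_subset lf' cyc by (auto simp: rooted_tree_altdef)
qed

section \<open>Grafting as the inverse of cutting\<close>

lemma graft_sel [simp]:
  "verts (graft G v H) = verts G <+> verts H" "rt (graft G v H) = Inl (rt G)"
  by (simp_all add: graft_def)

lemma doubleton_mem_image:
  assumes "inj f"
  shows "{f x, f y} \<in> (`) f ` E \<longleftrightarrow> {x, y} \<in> E"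
proof -
  have "{f x, f y} = f ` {x, y}" by simp
  moreover have "inj ((`) f)" using assms by (simp add: inj_on_image inj_on_def inj_image_eq_iff)
  ultimately show ?thesis by (simp only: inj_image_mem_iff)
qed

lemma Inr_mem_Inl_image: "Inr z \<in> B \<Longrightarrow> B \<notin> (`) Inl ` E"
  by auto

lemma Inl_mem_Inr_image: "Inl z \<in> B \<Longrightarrow> B \<notin> (`) Inr ` E"
  by auto

lemma graft_edges [simp]:
  "{Inl x, Inl y} \<in> edges (graft G v H) \<longleftrightarrow> {x, y} \<in> edges G"
  "{Inr x', Inr y'} \<in> edges (graft G v H) \<longleftrightarrow> {x', y'} \<in> edges H"
  "{Inl x, Inr y'} \<in> edges (graft G v H) \<longleftrightarrow> x = v \<and> y' = rt H"
  "{Inr y', Inl x} \<in> edges (graft G v H) \<longleftrightarrow> x = v \<and> y' = rt H"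
proof -
  show "{Inl x, Inl y} \<in> edges (graft G v H) \<longleftrightarrow> {x, y} \<in> edges G"
    using Inl_mem_Inr_image[of x "{Inl x, Inl y}" "edges H"]
    by (simp add: graft_def doubleton_mem_image doubleton_eq_iff)
  show "{Inr x', Inr y'} \<in> edges (graft G v H) \<longleftrightarrow> {x', y'} \<in> edges H"
    using Inr_mem_Inl_image[of x' "{Inr x', Inr y'}" "edges G"]
    by (simp add: graft_def doubleton_mem_image doubleton_eq_iff)
  show *: "{Inl x, Inr y'} \<in> edges (graft G v H) \<longleftrightarrow> x = v \<and> y' = rt H"
    using Inr_mem_Inl_image[of y' "{Inl x, Inr y'}" "edges G"]
      Inl_mem_Inr_image[of x "{Inl x, Inr y'}" "edges H"]
    by (simp add: graft_def doubleton_eq_iff)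
  show "{Inr y', Inl x} \<in> edges (graft G v H) \<longleftrightarrow> x = v \<and> y' = rt H"
    using * by (simp add: insert_commute)
qed

text \<open>From a graft to a cut: the grafting edge, carried over to \<open>R\<close>, cuts \<open>R\<close> into copies of the two trees.\<close>

lemma graft_cuts:
  assumes iso: "is_iso \<phi> (graft T v S) R" and v: "v \<in> verts T"
    and T: "connected_graph T" "loopfree T" "rt T \<in> verts T"
    and S: "connected_graph S" "loopfree S" "rt S \<in> verts S"
    and R: "loopfree R" "connected_graph R"
  defines "e \<equiv> {\<phi> (Inl v), \<phi> (Inr (rt S))}"
  shows "cuts R (\<phi> ` Inl ` verts T) (\<phi> ` Inr ` verts S) (\<phi> (Inl v)) (\<phi> (Inr (rt S)))"
    and "is_iso (\<phi> \<circ> Inl) T (cut_R R e)" and "is_iso (\<phi> \<circ> Inr) S (cut_P R e)"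
proof -
  have bij: "bij_betw \<phi> (verts T <+> verts S) (verts R)" and rt: "\<phi> (Inl (rt T)) = rt R"
    using iso by (auto simp: is_iso_def)
  have inj: "inj_on \<phi> (verts T <+> verts S)" using bij by (rule bij_betw_imp_inj_on)
  have im: "\<phi> ` (verts T <+> verts S) = verts R" using bij by (rule bij_betw_imp_surj_on)
  have e: "{x, y} \<in> edges (graft T v S) \<longleftrightarrow> {\<phi> x, \<phi> y} \<in> edges R"
    if "x \<in> verts T <+> verts S" "y \<in> verts T <+> verts S" for x y
    using iso that by (simp add: is_iso_def)
  have eq: "\<phi> x = \<phi> y \<longleftrightarrow> x = y" if "x \<in> verts T <+> verts S" "y \<in> verts T <+> verts S" for x y
    using inj that by (auto simp: inj_on_def)
  let ?A = "\<phi> ` Inl ` verts T" and ?W = "\<phi> ` Inr ` verts S"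
  have edge: "f \<subseteq> ?A \<or> f \<subseteq> ?W" if f: "f \<in> edges R - {e}" for f
  proof -
    obtain p q where pq: "f = {p, q}" "p \<in> verts R" "q \<in> verts R"
      using loopfreeE[OF R(1)] f by (metis DiffD1)
    then obtain x y where xy: "x \<in> verts T <+> verts S" "p = \<phi> x" "y \<in> verts T <+> verts S" "q = \<phi> y"
      using im by (metis imageE)
    have "{x, y} \<in> edges (graft T v S)" using e[OF xy(1,3)] f pq xy by simp
    then show ?thesis using xy pq f
      by (cases x; cases y) (auto simp: e_def insert_commute)
  qed
  have reach: "(rt R, \<phi> (Inl t)) \<in> (adj (edges R - {e}))\<^sup>*" if t: "t \<in> verts T" for t
  proof -
    have "(rt T, t) \<in> (adj (edges T))\<^sup>*"
      using T t by (simp add: connected_graph_def)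
    then have "((\<phi> \<circ> Inl) (rt T), (\<phi> \<circ> Inl) t) \<in> (adj (edges R - {e}))\<^sup>*"
    proof (rule rtrancl_image)
      fix x y assume xy: "(x, y) \<in> adj (edges T)"
      then have xy': "x \<in> verts T" "y \<in> verts T" "x \<noteq> y"
        using loopfreeD[OF T(2), of x y] by (auto simp: adj_iff)
      then have "{\<phi> (Inl x), \<phi> (Inl y)} \<in> edges R"
        using e[of "Inl x" "Inl y"] xy by (simp add: adj_iff InlI)
      then show "((\<phi> \<circ> Inl) x, (\<phi> \<circ> Inl) y) \<in> adj (edges R - {e})"
        using xy' v S(3) by (auto simp: adj_iff e_def doubleton_eq_iff eq InlI InrI)
    qed
    then show ?thesis using rt by simp
  qed
  show c: "cuts R ?A ?W (\<phi> (Inl v)) (\<phi> (Inr (rt S)))"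
    unfolding cuts_def e_def[symmetric]
  proof (intro conjI ballI)
    show "verts R = ?A \<union> ?W"
      using im by (simp add: Plus_def image_Un)
    show "?A \<inter> ?W = {}"
      by (auto simp: eq InlI InrI)
    show "rt R \<in> ?A" using rt T(3) by force
    show "e \<in> edges R"
      unfolding e_def using e[of "Inl v" "Inr (rt S)"] v S(3) by (simp add: InlI InrI)
  qed (use v S(3) edge reach in auto)
  have bA: "bij_betw (\<phi> \<circ> Inl) (verts T) ?A" and bW: "bij_betw (\<phi> \<circ> Inr) (verts S) ?W"
    by (auto simp: bij_betw_def inj_on_def eq InlI InrI)
  show "is_iso (\<phi> \<circ> Inl) T (cut_R R e)"
    unfolding e_def cut_R_eq[OF c] is_iso_def
    using bA rt v S(3) by (auto simp: e[symmetric] eq doubleton_eq_iff InlI InrI)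
  show "is_iso (\<phi> \<circ> Inr) S (cut_P R e)"
    unfolding e_def cut_P_eq[OF c R(2)] is_iso_def
    using bW rt v S(3) by (auto simp: e[symmetric] eq doubleton_eq_iff InlI InrI)
qed

text \<open>From a cut to a graft: isomorphisms onto the two pieces glue, since \<open>{a, b}\<close> is the only edge between
  them.\<close>

lemma cuts_graft:
  assumes c: "cuts R A W a b" and R: "connected_graph R" "loopfree R"
    and 1: "is_iso \<psi>1 T (cut_R R {a, b})" and 2: "is_iso \<psi>2 S (cut_P R {a, b})"
    and v: "v \<in> verts T" "\<psi>1 v = a" and rS: "rt S \<in> verts S"
  shows "is_iso (case_sum \<psi>1 \<psi>2) (graft T v S) R"
proof -
  note i1 = 1[unfolded cut_R_eq[OF c] is_iso_def, simplified]
  note i2 = 2[unfolded cut_P_eq[OF c R(1)] is_iso_def, simplified]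
  have b1: "bij_betw \<psi>1 (verts T) A" and b2: "bij_betw \<psi>2 (verts S) W"
    using i1 i2 by auto
  have disj: "A \<inter> W = {}" and V: "verts R = A \<union> W" and ab: "a \<in> A" "b \<in> W" "{a, b} \<in> edges R"
    using c by (auto simp: cuts_def)
  have in1: "\<psi>1 x \<in> A" if "x \<in> verts T" for x using b1 that by (auto simp: bij_betw_def)
  have in2: "\<psi>2 x \<in> W" if "x \<in> verts S" for x using b2 that by (auto simp: bij_betw_def)
  have inj1: "\<psi>1 x = \<psi>1 y \<longleftrightarrow> x = y" if "x \<in> verts T" "y \<in> verts T" for x y
    using b1 that by (auto simp: bij_betw_def inj_on_def)
  have inj2: "\<psi>2 x = \<psi>2 y \<longleftrightarrow> x = y" if "x \<in> verts S" "y \<in> verts S" for x y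
    using b2 that by (auto simp: bij_betw_def inj_on_def)
  have "bij_betw (case_sum \<psi>1 \<psi>2) (Inl ` verts T \<union> Inr ` verts S) (A \<union> W)"
  proof (rule bij_betw_combine)
    show "bij_betw (case_sum \<psi>1 \<psi>2) (Inl ` verts T) A"
      using b1 by (auto simp: bij_betw_def inj_on_def image_image)
    show "bij_betw (case_sum \<psi>1 \<psi>2) (Inr ` verts S) W"
      using b2 by (auto simp: bij_betw_def inj_on_def image_image)
  qed (rule disj)
  then have bij: "bij_betw (case_sum \<psi>1 \<psi>2) (verts T <+> verts S) (verts R)"
    by (simp add: Plus_def V)
  have e1: "{x, y} \<in> edges T \<longleftrightarrow> {\<psi>1 x, \<psi>1 y} \<in> edges R" if "x \<in> verts T" "y \<in> verts T" for x y
  proof -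
    have "{\<psi>1 x, \<psi>1 y} \<noteq> {a, b}" using in1 that ab disj by (auto simp: doubleton_eq_iff)
    then show ?thesis using i1 that in1 by auto
  qed
  have e2: "{x, y} \<in> edges S \<longleftrightarrow> {\<psi>2 x, \<psi>2 y} \<in> edges R" if "x \<in> verts S" "y \<in> verts S" for x y
  proof -
    have "{\<psi>2 x, \<psi>2 y} \<noteq> {a, b}" using in2 that ab disj by (auto simp: doubleton_eq_iff)
    then show ?thesis using i2 that in2 by auto
  qed
  have rb: "\<psi>2 (rt S) = b" using i2 by simp
  have e3: "x = v \<and> y = rt S \<longleftrightarrow> {\<psi>1 x, \<psi>2 y} \<in> edges R" if "x \<in> verts T" "y \<in> verts S" for x y
  proof
    assume "x = v \<and> y = rt S"
    then show "{\<psi>1 x, \<psi>2 y} \<in> edges R" using v ab rb by simp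
  next
    assume "{\<psi>1 x, \<psi>2 y} \<in> edges R"
    from cuts_cross[OF c in1[OF that(1)] in2[OF that(2)] this]
    show "x = v \<and> y = rt S" using inj1 inj2 v rS rb that by metis
  qed
  show ?thesis
    unfolding is_iso_def graft_sel
  proof (intro conjI ballI bij)
    show "case_sum \<psi>1 \<psi>2 (Inl (rt T)) = rt R" using i1 by simp
  next
    fix x y assume "x \<in> verts T <+> verts S" "y \<in> verts T <+> verts S"
    then show "{x, y} \<in> edges (graft T v S) \<longleftrightarrow> {case_sum \<psi>1 \<psi>2 x, case_sum \<psi>1 \<psi>2 y} \<in> edges R"
      by (elim PlusE) (simp_all add: e1 e2 e3 insert_commute[of "\<psi>2 _" "\<psi>1 _"])
  qed
qed

section \<open>Counting isomorphisms: the relation between alpha and beta\<close>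

definition rooted :: "'v rgraph \<Rightarrow> bool" where
  "rooted G \<longleftrightarrow> finite (verts G) \<and> rt G \<in> verts G"

lemma rooted_tree_rooted: "rooted_tree G \<Longrightarrow> rooted G"
  by (simp add: rooted_tree_altdef rooted_def)

text \<open>Only extensional functions are counted, so that each isomorphism appears once and the set is finite.\<close>

definition isos :: "'v rgraph \<Rightarrow> 'w rgraph \<Rightarrow> ('v \<Rightarrow> 'w) set" where
  "isos G H = {\<phi> \<in> extensional (verts G). is_iso \<phi> G H}"

lemma restrict_mem_isos: "rooted G \<Longrightarrow> is_iso \<phi> G H \<Longrightarrow> restrict \<phi> (verts G) \<in> isos G H"
  by (auto simp: isos_def rooted_def intro: is_iso_cong)

lemma finite_isos: "rooted G \<Longrightarrow> rooted H \<Longrightarrow> finite (isos G H)"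
proof -
  assume "rooted G" "rooted H"
  then have "finite (PiE (verts G) (\<lambda>_. verts H))"
    by (auto simp: rooted_def intro: finite_PiE)
  moreover have "isos G H \<subseteq> PiE (verts G) (\<lambda>_. verts H)"
    by (auto simp: isos_def is_iso_def PiE_def bij_betwE)
  ultimately show ?thesis by (rule rev_finite_subset)
qed

lemma isos_empty_iff: "rooted G \<Longrightarrow> isos G H = {} \<longleftrightarrow> \<not> G \<cong>\<^sub>r H"
  unfolding rgraph_iso_iff by (metis (no_types, lifting) equals0D equals0I isos_def mem_Collect_eq restrict_mem_isos)

text \<open>Composing with fixed isomorphisms on both sides is injective on isomorphisms.\<close>

lemma card_isos_le:
  assumes G: "rooted G'" "G' \<cong>\<^sub>r G" and H: "H \<cong>\<^sub>r H'" "rooted H'"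
  shows "card (isos G H) \<le> card (isos G' H')"
proof -
  obtain \<alpha> \<beta> where a: "is_iso \<alpha> G' G" and b: "is_iso \<beta> H H'"
    using G H by (auto simp: rgraph_iso_iff)
  let ?f = "\<lambda>\<phi>. restrict (\<beta> \<circ> (\<phi> \<circ> \<alpha>)) (verts G')"
  have "inj_on ?f (isos G H)"
  proof (rule inj_onI)
    fix \<phi> \<psi> assume p: "\<phi> \<in> isos G H" "\<psi> \<in> isos G H" "?f \<phi> = ?f \<psi>"
    show "\<phi> = \<psi>"
    proof (rule extensionalityI[of _ "verts G"])
      fix x assume "x \<in> verts G"
      then have "x \<in> \<alpha> ` verts G'"
        using a by (simp add: is_iso_def bij_betw_def)
      then obtain y where y: "y \<in> verts G'" "x = \<alpha> y"
        by blast
      have "\<phi> x \<in> verts H" "\<psi> x \<in> verts H"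
        using p \<open>x \<in> verts G\<close> by (auto simp: isos_def is_iso_def bij_betw_def)
      moreover have "\<beta> (\<phi> x) = \<beta> (\<psi> x)"
        using fun_cong[OF p(3), of y] y by simp
      ultimately show "\<phi> x = \<psi> x"
        using b by (auto simp: is_iso_def bij_betw_def inj_on_def)
    qed (use p in \<open>auto simp: isos_def\<close>)
  qed
  moreover have "?f \<phi> \<in> isos G' H'" if "\<phi> \<in> isos G H" for \<phi>
  proof -
    have "is_iso \<phi> G H" using that by (simp add: isos_def)
    from restrict_mem_isos[OF G(1) is_iso_comp[OF is_iso_comp[OF a this] b]]
    show ?thesis .
  qed
  then have "?f ` isos G H \<subseteq> isos G' H'"
    by blast
  ultimately show ?thesis
    using card_inj_on_le[OF _ _ finite_isos[OF G(1) H(2)]] by blast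
qed

lemma card_isos_eq:
  assumes "rooted G" "rooted G'" "G \<cong>\<^sub>r G'" "rooted H" "rooted H'" "H \<cong>\<^sub>r H'"
  shows "card (isos G H) = card (isos G' H')"
proof (rule antisym)
  have s: "G' \<cong>\<^sub>r G" "H' \<cong>\<^sub>r H"
    using assms rgraph_iso_sym by (auto simp: rooted_def)
  show "card (isos G H) \<le> card (isos G' H')" "card (isos G' H') \<le> card (isos G H)"
    using card_isos_le[OF assms(2) s(1) assms(6,5)] card_isos_le[OF assms(1,3) s(2) assms(4)] by simp_all
qed

text \<open>The order of the automorphism group of a rooted tree.\<close>

definition sigma :: "rtree \<Rightarrow> nat" where
  "sigma t = card (isos (rep_rtree t) (rep_rtree t))"

lemma rooted_rep: "rooted (rep_rtree t)"
  by (rule rooted_tree_rooted[OF rooted_tree_rep])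

lemma sigma_pos: "sigma t > 0"
  by (simp add: sigma_def card_gt_0_iff isos_empty_iff rooted_rep rgraph_iso_refl finite_isos)

lemma card_isos_to_rep:
  assumes "rooted G"
  shows "card (isos G (rep_rtree t)) = (if rep_rtree t \<cong>\<^sub>r G then sigma t else 0)"
proof (cases "rep_rtree t \<cong>\<^sub>r G")
  case True
  then show ?thesis unfolding sigma_def
    using card_isos_eq[OF rooted_rep assms True rooted_rep rooted_rep rgraph_iso_refl] by simp
next
  case False
  then have "\<not> G \<cong>\<^sub>r rep_rtree t"
    using rgraph_iso_sym[of G "rep_rtree t"] assms by (auto simp: rooted_def)
  then have "isos G (rep_rtree t) = {}" by (simp only: isos_empty_iff[OF assms] not_False_eq_True)
  then show ?thesis using False by simp
qed

lemma card_isos_from_rep: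
  assumes "rooted G"
  shows "card (isos (rep_rtree t) G) = (if G \<cong>\<^sub>r rep_rtree t then sigma t else 0)"
proof (cases "G \<cong>\<^sub>r rep_rtree t")
  case True
  then show ?thesis unfolding sigma_def
    using card_isos_eq[OF rooted_rep rooted_rep rgraph_iso_refl assms rooted_rep True] by simp
next
  case False
  then have "\<not> rep_rtree t \<cong>\<^sub>r G"
    using rgraph_iso_sym[of "rep_rtree t" G] rooted_rep[of t] by (auto simp: rooted_def)
  then have "isos (rep_rtree t) G = {}" by (simp only: isos_empty_iff[OF rooted_rep] not_False_eq_True)
  then show ?thesis using False by simp
qed

text \<open>The two constructions above are inverse to each other once isomorphisms are recorded: a vertex with
  an isomorphism from the graft to \<open>R\<close> corresponds to an edge of \<open>R\<close> with isomorphisms onto both pieces.\<close>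

lemma bij_graft_cut:
  assumes T: "rooted_tree T" and S: "rooted_tree S" and R: "rooted_tree R"
  shows "bij_betw (\<lambda>(v, \<phi>). ({\<phi> (Inl v), \<phi> (Inr (rt S))}, restrict (\<phi> \<circ> Inl) (verts T), restrict (\<phi> \<circ> Inr) (verts S)))
    (Sigma (verts T) (\<lambda>v. isos (graft T v S) R))
    (Sigma (edges R) (\<lambda>e. isos T (cut_R R e) \<times> isos S (cut_P R e)))" (is "bij_betw ?F ?X ?Y")
proof (rule bij_betw_imageI)
  have rt: "connected_graph T" "loopfree T" "rt T \<in> verts T"
    "connected_graph S" "loopfree S" "rt S \<in> verts S" "loopfree R" "connected_graph R"
    using T S R by (auto simp: rooted_tree_altdef)
  show "inj_on ?F ?X"
  proof (rule inj_onI, clarify)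
    fix v \<phi> w \<psi>
    assume v: "v \<in> verts T" and p: "\<phi> \<in> isos (graft T v S) R"
      and w: "w \<in> verts T" and q: "\<psi> \<in> isos (graft T w S) R"
      and e: "{\<phi> (Inl v), \<phi> (Inr (rt S))} = {\<psi> (Inl w), \<psi> (Inr (rt S))}"
      and l: "restrict (\<phi> \<circ> Inl) (verts T) = restrict (\<psi> \<circ> Inl) (verts T)"
      and r: "restrict (\<phi> \<circ> Inr) (verts S) = restrict (\<psi> \<circ> Inr) (verts S)"
    have l': "\<phi> (Inl x) = \<psi> (Inl x)" if "x \<in> verts T" for x
      using fun_cong[OF l, of x] that by simp
    have r': "\<phi> (Inr x) = \<psi> (Inr x)" if "x \<in> verts S" for x
      using fun_cong[OF r, of x] that by simp
    have pq: "\<phi> = \<psi>"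
      by (rule extensionalityI[of _ "verts T <+> verts S"])
        (use p q l' r' in \<open>auto simp: isos_def\<close>)
    have "inj_on \<phi> (verts T <+> verts S)"
      using p by (simp add: isos_def is_iso_def bij_betw_def)
    then show "v = w \<and> \<phi> = \<psi>"
      using e v w rt(6) pq by (auto simp: doubleton_eq_iff dest!: inj_onD)
  qed
  show "?F ` ?X = ?Y"
  proof (intro equalityI subsetI)
    fix y assume "y \<in> ?F ` ?X"
    then obtain v \<phi> where v: "v \<in> verts T" and p: "\<phi> \<in> isos (graft T v S) R" and y: "y = ?F (v, \<phi>)"
      by blast
    have iso: "is_iso \<phi> (graft T v S) R" using p by (simp add: isos_def)
    note c = graft_cuts[OF iso v rt]
    have "{\<phi> (Inl v), \<phi> (Inr (rt S))} \<in> edges R"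
      using c(1) by (simp add: cuts_def)
    then show "y \<in> ?Y"
      using y restrict_mem_isos[OF rooted_tree_rooted[OF T] c(2)]
        restrict_mem_isos[OF rooted_tree_rooted[OF S] c(3)] by simp
  next
    fix y assume "y \<in> ?Y"
    then obtain e \<psi>1 \<psi>2 where y: "y = (e, \<psi>1, \<psi>2)" "e \<in> edges R"
      "\<psi>1 \<in> isos T (cut_R R e)" "\<psi>2 \<in> isos S (cut_P R e)" by blast
    obtain a b where ab: "e = {a, b}" and c: "cuts R (root_side R e) (verts R - root_side R e) a b"
      using tree_edge_cuts[OF R y(2)] by blast
    have i1: "is_iso \<psi>1 T (cut_R R {a, b})" and i2: "is_iso \<psi>2 S (cut_P R {a, b})"
      using y ab by (auto simp: isos_def)
    have "a \<in> root_side R e" using c by (simp add: cuts_def)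
    then have "a \<in> \<psi>1 ` verts T"
      using i1 unfolding cut_R_eq[OF c] is_iso_def bij_betw_def by simp
    then obtain v where v: "v \<in> verts T" "\<psi>1 v = a"
      by blast
    have iso: "is_iso (case_sum \<psi>1 \<psi>2) (graft T v S) R"
      by (rule cuts_graft[OF c rt(8,7) i1 i2 v rt(6)])
    have b: "\<psi>2 (rt S) = b"
      using i2 unfolding cut_P_eq[OF c rt(8)] is_iso_def by simp
    let ?\<phi> = "restrict (case_sum \<psi>1 \<psi>2) (verts T <+> verts S)"
    have rg: "rooted (graft T v S)"
      using rooted_tree_rooted[OF T] rooted_tree_rooted[OF S] by (simp add: rooted_def InlI)
    have "?\<phi> \<in> isos (graft T v S) R"
      using restrict_mem_isos[OF rg iso] by (simp only: graft_sel)
    moreover have "?F (v, ?\<phi>) = y"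
    proof -
      have "restrict (?\<phi> \<circ> Inl) (verts T) = \<psi>1"
        by (rule extensionalityI[of _ "verts T"]) (use y in \<open>auto simp: isos_def InlI\<close>)
      moreover have "restrict (?\<phi> \<circ> Inr) (verts S) = \<psi>2"
        by (rule extensionalityI[of _ "verts S"]) (use y in \<open>auto simp: isos_def InrI\<close>)
      ultimately show ?thesis using v b ab y rt(6) by (simp add: InlI InrI)
    qed
    ultimately show "y \<in> ?F ` ?X" using v by (intro image_eqI[of _ _ "(v, ?\<phi>)"]) auto
  qed
qed

lemma sum_indicator_card:
  assumes "finite A"
  shows "(\<Sum>x\<in>A. if P x then c else 0) = card {x \<in> A. P x} * (c :: nat)"
  using assms by (simp add: sum.If_cases Int_def)

lemma finite_edges: "rooted_tree G \<Longrightarrow> finite (edges G)"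
proof -
  assume "rooted_tree G"
  then have "finite (Pow (verts G))" "edges G \<subseteq> Pow (verts G)"
    by (auto simp: rooted_tree_altdef elim!: loopfreeE)
  then show ?thesis by (rule rev_finite_subset)
qed

lemma cut_rooted:
  assumes "rooted_tree G" "e \<in> edges G"
  shows "rooted_tree (cut_R G e)" "rooted_tree (cut_P G e)"
proof -
  obtain a b where ab: "e = {a, b}" and c: "cuts G (root_side G e) (verts G - root_side G e) a b"
    using tree_edge_cuts[OF assms] by blast
  have "connected_graph G" using assms by (simp add: rooted_tree_altdef)
  then show "rooted_tree (cut_R G e)" "rooted_tree (cut_P G e)"
    using cuts_rooted_tree[OF assms(1) c] cut_R_eq[OF c] cut_P_eq[OF c] by (simp_all add: ab)
qed

text \<open>Both sides count the pairs matched by \<open>bij_graft_cut\<close>. The set of isomorphisms to \<open>r\<close> is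
  empty or has \<open>sigma r\<close> elements, so counting grafts gives the left side; counting cuts gives the right side.\<close>

theorem beta_sigma: "beta r s t * sigma r = alpha s r t * sigma s * sigma t"
proof -
  let ?T = "rep_rtree t" and ?S = "rep_rtree s" and ?R = "rep_rtree r"
  have T: "rooted_tree ?T" and S: "rooted_tree ?S" and R: "rooted_tree ?R"
    by (rule rooted_tree_rep)+
  let ?X = "Sigma (verts ?T) (\<lambda>v. isos (graft ?T v ?S) ?R)"
  let ?Y = "Sigma (edges ?R) (\<lambda>e. isos ?T (cut_R ?R e) \<times> isos ?S (cut_P ?R e))"
  have g: "rooted (graft ?T v ?S)" for v
    using rooted_rep[of t] rooted_rep[of s] by (simp add: rooted_def InlI)
  have finT: "finite (verts ?T)" using T by (simp add: rooted_tree_altdef)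
  have "card ?X = (\<Sum>v\<in>verts ?T. card (isos (graft ?T v ?S) ?R))"
    using finT finite_isos[OF g rooted_rep] by simp
  also have "\<dots> = beta r s t * sigma r"
    by (simp add: card_isos_to_rep[OF g] sum_indicator_card[OF finT] beta_def)
  finally have X: "card ?X = beta r s t * sigma r" .
  have c: "rooted (cut_R ?R e)" "rooted (cut_P ?R e)" if "e \<in> edges ?R" for e
    using cut_rooted[OF R that] rooted_tree_rooted by auto
  have "card ?Y = (\<Sum>e\<in>edges ?R. card (isos ?T (cut_R ?R e)) * card (isos ?S (cut_P ?R e)))"
    using finite_edges[OF R] c finite_isos[OF rooted_rep]
    by (subst card_SigmaI) (auto simp: card_cartesian_product intro!: finite_cartesian_product)
  also have "\<dots> = (\<Sum>e\<in>edges ?R. if cut_R ?R e \<cong>\<^sub>r ?T \<and> cut_P ?R e \<cong>\<^sub>r ?S then sigma t * sigma s else 0)"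
    by (rule sum.cong) (auto simp: card_isos_from_rep c)
  also have "\<dots> = alpha s r t * sigma s * sigma t"
    by (simp add: sum_indicator_card[OF finite_edges[OF R]] alpha_def)
  finally show ?thesis
    using X bij_betw_same_card[OF bij_graft_cut[OF T S R]] by simp
qed

section \<open>Grafts of trees are trees\<close>

lemma switch_index:
  assumes "i \<le> j" "P i" "\<not> P j"
  shows "\<exists>k\<ge>i. k < j \<and> P k \<and> \<not> P (Suc k)"
  using assms
proof (induct j rule: dec_induct)
  case (step n)
  then show ?case by (cases "P n") (auto intro: less_SucI)
qed simp

lemma is_cycle_map_inv:
  assumes p: "is_cycle K (map f q)" and inj: "inj f"
    and V: "\<And>x. f x \<in> verts K \<Longrightarrow> x \<in> verts G" and E: "\<And>x y. {f x, f y} \<in> edges K \<Longrightarrow> {x, y} \<in> edges G"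
  shows "is_cycle G q"
proof -
  have "q \<noteq> []" using p by (auto simp: is_cycle_def)
  then have "{f (last q), f (hd q)} \<in> edges K"
    using p by (simp add: is_cycle_def last_map hd_map)
  then show ?thesis
    using p E V by (auto simp: is_cycle_def distinct_map)
qed

lemma all_in_range:
  assumes "\<And>i. i < length p \<Longrightarrow> p ! i \<in> range f"
  obtains q where "p = map f q"
proof -
  have "\<forall>x\<in>set p. \<exists>y. x = f y" using assms by (fastforce simp: in_set_conv_nth)
  then show thesis using that by (metis ex_map_conv)
qed

text \<open>A cycle lying on one side of the grafting edge is a cycle of that side. Any other cycle changes sides
  at least twice, at different positions, and both times along the grafting edge, so it repeats a vertex.\<close>

lemma graft_acyclic:
  assumes "\<nexists>p. is_cycle G p" "\<nexists>p. is_cycle H p"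
  shows "\<nexists>p. is_cycle (graft G v H) p"
proof
  assume "\<exists>p. is_cycle (graft G v H) p"
  then obtain p where p: "is_cycle (graft G v H) p" ..
  let ?n = "length p" and ?E = "edges (graft G v H)"
  have n: "?n \<ge> 3" and d: "distinct p" and e: "\<And>i. Suc i < ?n \<Longrightarrow> {p ! i, p ! Suc i} \<in> ?E"
    and w: "{last p, hd p} \<in> ?E"
    using p by (auto simp: is_cycle_def)
  have n1: "?n - 1 < ?n" using n by linarith
  have "p \<noteq> []" using n by auto
  then have w: "{p ! (?n - 1), p ! 0} \<in> ?E"
    using w by (simp add: last_conv_nth hd_conv_nth)
  let ?L = "\<lambda>i. isl (p ! i)" and ?a = "Inl v" and ?b = "Inr (rt H)"
  have x: "x = ?a \<and> y = ?b" if "{x, y} \<in> ?E" "isl x" "\<not> isl y" for x y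
    using that by (cases x; cases y) auto
  have up: "\<exists>k<j. p ! k = ?a \<and> p ! Suc k = ?b" if ij: "i \<le> j" "j < ?n" "?L i" "\<not> ?L j" for i j
  proof -
    obtain k where "k < j" "?L k" "\<not> ?L (Suc k)"
      using switch_index[of i j ?L] ij by auto
    then show ?thesis using x[OF e[of k]] ij by auto
  qed
  have down: "\<exists>k<j. p ! k = ?b \<and> p ! Suc k = ?a" if ij: "i \<le> j" "j < ?n" "\<not> ?L i" "?L j" for i j
  proof -
    obtain k where "k < j" "\<not> ?L k" "?L (Suc k)"
      using switch_index[of i j "\<lambda>i. \<not> ?L i"] ij by auto
    then show ?thesis using x[of "p ! Suc k" "p ! k"] e[of k] ij by (auto simp: insert_commute)
  qed
  have idx: "i = j" if "p ! i = p ! j" "i < ?n" "j < ?n" for i j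
    using nth_eq_iff_index_eq[OF d] that by blast
  \<comment> \<open>crossing in both directions inside the list needs the two ends of the grafting edge in both orders\<close>
  have both: False if k: "Suc k < ?n" "p ! k = ?a" "p ! Suc k = ?b" and l: "Suc l < ?n" "p ! l = ?b" "p ! Suc l = ?a" for k l
    using idx[of k "Suc l"] idx[of "Suc k" l] k l by simp
  show False
  proof (cases "?L 0"; cases "?L (?n - 1)")
    assume L: "?L 0" "?L (?n - 1)"
    show False
    proof (cases "\<forall>i<?n. ?L i")
      case True
      obtain q where "p = map Inl q"
      proof (rule all_in_range[of p Inl])
        show "p ! i \<in> range Inl" if "i < ?n" for i
          using True that by (cases "p ! i") auto
      qed
      then have "is_cycle G q"
        using p by (auto intro!: is_cycle_map_inv[of "graft G v H" Inl q G])
      then show False using assms by blast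
    next
      case False
      then obtain i where i: "i < ?n" "\<not> ?L i" by blast
      have i': "i \<le> ?n - 1" "?n - 1 < ?n" using i n by linarith+
      obtain k where k: "k < i" "p ! k = ?a" "p ! Suc k = ?b" using up[of 0 i] L i n by auto
      obtain l where l: "l < ?n - 1" "p ! l = ?b" "p ! Suc l = ?a" using down[of i "?n - 1"] L i i' by auto
      have "Suc l < ?n" using l by linarith
      then show False using both[of k l] k l i by simp
    qed
  next
    assume L: "\<not> ?L 0" "\<not> ?L (?n - 1)"
    show False
    proof (cases "\<forall>i<?n. \<not> ?L i")
      case True
      obtain q where "p = map Inr q"
      proof (rule all_in_range[of p Inr])
        show "p ! i \<in> range Inr" if "i < ?n" for i
          using True that by (cases "p ! i") auto
      qed
      then have "is_cycle H q"
        using p by (auto intro!: is_cycle_map_inv[of "graft G v H" Inr q H])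
      then show False using assms by blast
    next
      case False
      then obtain i where i: "i < ?n" "?L i" by blast
      have i': "i \<le> ?n - 1" "?n - 1 < ?n" using i n by linarith+
      obtain k where k: "k < i" "p ! k = ?b" "p ! Suc k = ?a" using down[of 0 i] L i n by auto
      obtain l where l: "l < ?n - 1" "p ! l = ?a" "p ! Suc l = ?b" using up[of i "?n - 1"] L i i' by auto
      have "Suc l < ?n" using l by linarith
      then show False using both[of l k] k l i by simp
    qed
  next
    assume L: "?L 0" "\<not> ?L (?n - 1)"
    obtain k where k: "k < ?n - 1" "p ! k = ?a" "p ! Suc k = ?b" using up[of 0 "?n - 1"] L n1 by auto
    have "p ! 0 = ?a" "p ! (?n - 1) = ?b" using x[of "p ! 0" "p ! (?n - 1)"] w L by (auto simp: insert_commute)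
    then have "k = 0" "Suc k = ?n - 1" using idx[of k 0] idx[of "Suc k" "?n - 1"] k n1 \<open>p \<noteq> []\<close> by auto
    then show False using n by simp
  next
    assume L: "\<not> ?L 0" "?L (?n - 1)"
    obtain k where k: "k < ?n - 1" "p ! k = ?b" "p ! Suc k = ?a" using down[of 0 "?n - 1"] L n1 by auto
    have "p ! 0 = ?b" "p ! (?n - 1) = ?a" using x[of "p ! (?n - 1)" "p ! 0"] w L by auto
    then have "k = 0" "Suc k = ?n - 1" using idx[of k 0] idx[of "Suc k" "?n - 1"] k n1 \<open>p \<noteq> []\<close> by auto
    then show False using n by simp
  qed
qed

lemma graft_loopfree:
  assumes "loopfree G" "loopfree H" "v \<in> verts G" "rt H \<in> verts H"
  shows "loopfree (graft G v H)"
proof -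
  have "\<exists>x y. f = {x, y} \<and> x \<in> verts G <+> verts H \<and> y \<in> verts G <+> verts H \<and> x \<noteq> y"
    if f: "f \<in> edges (graft G v H)" for f
  proof -
    have "f \<in> (`) Inl ` edges G \<or> f \<in> (`) Inr ` edges H \<or> f = {Inl v, Inr (rt H)}"
      using f by (auto simp: graft_def)
    then show ?thesis
    proof (elim disjE)
      assume "f \<in> (`) Inl ` edges G"
      then obtain g where g: "g \<in> edges G" "f = Inl ` g" by blast
      obtain x y where "g = {x, y}" "x \<in> verts G" "y \<in> verts G" "x \<noteq> y"
        using loopfreeE[OF assms(1) g(1)] by metis
      then show ?thesis using g by (intro exI[of _ "Inl x"] exI[of _ "Inl y"]) (simp add: InlI)
    next
      assume "f \<in> (`) Inr ` edges H"
      then obtain g where g: "g \<in> edges H" "f = Inr ` g" by blast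
      obtain x y where "g = {x, y}" "x \<in> verts H" "y \<in> verts H" "x \<noteq> y"
        using loopfreeE[OF assms(2) g(1)] by metis
      then show ?thesis using g by (intro exI[of _ "Inr x"] exI[of _ "Inr y"]) (simp add: InrI)
    next
      assume "f = {Inl v, Inr (rt H)}"
      then show ?thesis using assms(3,4) by (intro exI[of _ "Inl v"] exI[of _ "Inr (rt H)"]) (simp add: InlI InrI)
    qed
  qed
  then show ?thesis unfolding loopfree_def graft_sel by blast
qed

lemma graft_rooted_tree:
  assumes G: "rooted_tree G" and H: "rooted_tree H" and v: "v \<in> verts G"
  shows "rooted_tree (graft G v H)"
proof -
  let ?E = "edges (graft G v H)"
  have l: "(Inl (rt G), Inl x) \<in> (adj ?E)\<^sup>*" if "x \<in> verts G" for x
  proof (rule rtrancl_image[where f = Inl and r = "adj (edges G)"])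
    show "(rt G, x) \<in> (adj (edges G))\<^sup>*"
      using G that by (simp add: rooted_tree_altdef connected_graph_def)
  qed (simp add: adj_iff)
  have r: "(Inr (rt H), Inr x) \<in> (adj ?E)\<^sup>*" if "x \<in> verts H" for x
  proof (rule rtrancl_image[where f = Inr and r = "adj (edges H)"])
    show "(rt H, x) \<in> (adj (edges H))\<^sup>*"
      using H that by (simp add: rooted_tree_altdef connected_graph_def)
  qed (simp add: adj_iff)
  have "(Inl v, Inr (rt H)) \<in> adj ?E" by (simp add: adj_iff)
  then have "(Inl (rt G), Inr (rt H)) \<in> (adj ?E)\<^sup>*"
    by (rule rtrancl_into_rtrancl[OF l[OF v]])
  then have "(Inl (rt G), Inr x) \<in> (adj ?E)\<^sup>*" if "x \<in> verts H" for x
    using r[OF that] by (rule rtrancl_trans)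
  then have "connected_graph (graft G v H)"
    by (intro connected_graph_from_root[where c = "Inl (rt G)"]) (auto intro: l)
  moreover have "loopfree (graft G v H)"
    using G H v by (intro graft_loopfree) (auto simp: rooted_tree_altdef)
  moreover have "\<nexists>p. is_cycle (graft G v H) p"
    using G H by (intro graft_acyclic) (auto simp: rooted_tree_altdef)
  ultimately show ?thesis
    using G H by (simp add: rooted_tree_altdef InlI)
qed

text \<open>A rooted tree on any vertex type is renumbered by natural numbers.\<close>

lemma rtree_of_rooted_tree:
  assumes G: "rooted_tree G"
  obtains t where "rep_rtree t \<cong>\<^sub>r G"
proof -
  have fin: "finite (verts G)" and lf: "loopfree G" and rv: "rt G \<in> verts G"
    and conn: "connected_graph G" and ac: "\<nexists>p. is_cycle G p"
    using G by (auto simp: rooted_tree_altdef)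
  obtain f :: "_ \<Rightarrow> nat" and n where f: "bij_betw f (verts G) {..<n}"
    using ex_bij_betw_finite_nat[OF fin] by (auto simp: atLeast0LessThan)
  let ?g = "the_inv_into (verts G) f"
  let ?H = "RGraph {..<n} {{x, y} | x y. x < n \<and> y < n \<and> {?g x, ?g y} \<in> edges G} (f (rt G))"
  have g: "?g x \<in> verts G" "f (?g x) = x" if "x < n" for x
    using bij_betw_the_inv_into[OF f] that f_the_inv_into_f_bij_betw[OF f] by (auto simp: bij_betw_def)
  have gf: "?g (f x) = x" if "x \<in> verts G" for x
    using f that by (simp add: bij_betw_def the_inv_into_f_f)
  have fn: "f x < n" if "x \<in> verts G" for x
    using f that by (auto simp: bij_betw_def)
  have eH: "{x, y} \<in> edges ?H \<longleftrightarrow> x < n \<and> y < n \<and> {?g x, ?g y} \<in> edges G" for x y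
    by (auto simp: doubleton_eq_iff insert_commute)
  have iso: "is_iso ?g ?H G"
    unfolding is_iso_def using bij_betw_the_inv_into[OF f] gf[OF rv] by (simp add: eH del: rgraph.sel(2))
  have "loopfree ?H"
    unfolding loopfree_def using loopfreeD[OF lf] by (clarsimp, metis)
  moreover have "connected_graph ?H"
  proof (rule connected_graph_from_root[where c = "f (rt G)"])
    fix x assume "x \<in> verts ?H"
    then have x: "x < n" by simp
    have "(f (rt G), f (?g x)) \<in> (adj (edges ?H))\<^sup>*"
    proof (rule rtrancl_image[where f = f and r = "adj (edges G)"])
      show "(rt G, ?g x) \<in> (adj (edges G))\<^sup>*"
        using conn g(1)[OF x] rv by (simp add: connected_graph_def)
      fix u v assume "(u, v) \<in> adj (edges G)"
      then have uv: "{u, v} \<in> edges G" by (simp add: adj_iff)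
      then show "(f u, f v) \<in> adj (edges ?H)"
        unfolding adj_iff eH using loopfreeD[OF lf uv] by (simp add: gf fn)
    qed
    then show "(f (rt G), x) \<in> (adj (edges ?H))\<^sup>*" using g(2)[OF x] by simp
  qed
  moreover have "\<not> is_cycle ?H p" for p
  proof
    assume p: "is_cycle ?H p"
    have sub: "set p \<subseteq> {..<n}" using p by (simp add: is_cycle_def)
    have "inj_on ?g {..<n}" using bij_betw_the_inv_into[OF f] by (rule bij_betw_imp_inj_on)
    then have "distinct (map ?g p)"
      using p sub by (simp add: is_cycle_def distinct_map inj_on_subset)
    moreover have "{?g (p ! i), ?g (p ! Suc i)} \<in> edges G" if "Suc i < length p" for i
    proof -
      have "{p ! i, p ! Suc i} \<in> edges ?H" using p that unfolding is_cycle_def by blast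
      then show ?thesis unfolding eH by simp
    qed
    moreover have "{?g (last p), ?g (hd p)} \<in> edges G"
    proof -
      have "{last p, hd p} \<in> edges ?H" using p unfolding is_cycle_def by blast
      then show ?thesis unfolding eH by simp
    qed
    moreover have "set (map ?g p) \<subseteq> verts G" using sub g by auto
    moreover have "length p \<ge> 3" using p by (simp add: is_cycle_def)
    moreover have "p \<noteq> []" using p by (auto simp: is_cycle_def)
    ultimately have "is_cycle G (map ?g p)"
      unfolding is_cycle_def by (simp add: last_map hd_map)
    then show False using ac by blast
  qed
  ultimately have H: "rooted_tree ?H"
    unfolding rooted_tree_altdef using fn[OF rv] by auto
  then have "rep_rtree (abs_rtree ?H) \<cong>\<^sub>r ?H"
    using Quotient3_rep_abs[OF Quotient3_rtree, of ?H] rgraph_iso_refl[of ?H] by blast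
  then have "rep_rtree (abs_rtree ?H) \<cong>\<^sub>r G"
    using iso rgraph_iso_trans rgraph_iso_iff by blast
  then show thesis by (rule that)
qed

section \<open>Branches at the root\<close>

definition root_children :: "'v rgraph \<Rightarrow> 'v set" where
  "root_children G = {c. {rt G, c} \<in> edges G}"

text \<open>The branch at a child \<open>c\<close> of the root, described by the walks that avoid the root rather than by
  cutting the edge to \<open>c\<close>; this form is immediately invariant under isomorphisms.\<close>

definition branch :: "'v rgraph \<Rightarrow> 'v \<Rightarrow> 'v rgraph" where
  "branch G c = (let B = {v. (c, v) \<in> (adj {f \<in> edges G. rt G \<notin> f})\<^sup>*} in
     RGraph B {f \<in> edges G. f \<subseteq> B} c)"

lemma root_children_verts: "loopfree G \<Longrightarrow> root_children G \<subseteq> verts G - {rt G}"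
  by (auto simp: root_children_def dest: loopfreeD)

lemma root_children_iso:
  assumes "is_iso \<phi> G H" "loopfree G" "loopfree H" "rt G \<in> verts G"
  shows "root_children H = \<phi> ` root_children G"
proof -
  have e: "{rt G, c} \<in> edges G \<longleftrightarrow> {rt H, \<phi> c} \<in> edges H" if "c \<in> verts G" for c
    using assms(1,4) that by (auto simp: is_iso_def)
  have im: "\<phi> ` verts G = verts H" using assms(1) by (simp add: is_iso_def bij_betw_def)
  show ?thesis
  proof (intro equalityI subsetI)
    fix d assume d: "d \<in> root_children H"
    then have "d \<in> \<phi> ` verts G"
      using root_children_verts[OF assms(3)] im by auto
    then show "d \<in> \<phi> ` root_children G" using d e by (auto simp: root_children_def)
  next
    fix d assume "d \<in> \<phi> ` root_children G"
    then obtain c where c: "c \<in> root_children G" "d = \<phi> c" by blast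
    then have "c \<in> verts G" using root_children_verts[OF assms(2)] by auto
    then show "d \<in> root_children H" using c e by (simp add: root_children_def)
  qed
qed

lemma root_children_graft:
  "root_children (graft G v H) = Inl ` root_children G \<union> (if v = rt G then {Inr (rt H)} else {})"
proof -
  have "x \<in> root_children (graft G v H) \<longleftrightarrow> x \<in> Inl ` root_children G \<union> (if v = rt G then {Inr (rt H)} else {})" for x
    by (cases x) (auto simp: root_children_def)
  then show ?thesis by blast
qed

lemma branch_sel:
  "verts (branch G c) = {v. (c, v) \<in> (adj {f \<in> edges G. rt G \<notin> f})\<^sup>*}"
  "edges (branch G c) = {f \<in> edges G. f \<subseteq> verts (branch G c)}" "rt (branch G c) = c"
  by (simp_all add: branch_def Let_def)

lemma branch_closed:
  "x \<in> verts (branch G c) \<Longrightarrow> {x, y} \<in> edges G \<Longrightarrow> x \<noteq> rt G \<Longrightarrow> y \<noteq> rt G \<Longrightarrow> y \<in> verts (branch G c)"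
  by (auto simp: branch_sel adj_iff intro: rtrancl_into_rtrancl)

lemma branch_verts:
  assumes "loopfree G" "c \<in> verts G" "c \<noteq> rt G"
  shows "verts (branch G c) \<subseteq> verts G - {rt G}"
proof
  fix v assume "v \<in> verts (branch G c)"
  then have "(c, v) \<in> (adj {f \<in> edges G. rt G \<notin> f})\<^sup>*" by (simp add: branch_sel)
  then show "v \<in> verts G - {rt G}"
    by induct (use assms in \<open>auto simp: adj_iff dest: loopfreeD\<close>)
qed

text \<open>A walk avoiding the root is carried over by \<open>f\<close>; the last assumption says that walks
  avoiding the root cannot leave the image, so they can be carried back.\<close>

lemma branch_transport:
  assumes B: "verts (branch G c) \<subseteq> A" and inj: "inj_on f A"
    and e: "\<And>x y. x \<in> A \<Longrightarrow> y \<in> A \<Longrightarrow> {x, y} \<in> edges G \<longleftrightarrow> {f x, f y} \<in> edges K"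
    and nrt: "\<And>x. x \<in> A \<Longrightarrow> x \<noteq> rt G \<and> f x \<noteq> rt K"
    and out: "\<And>x z. x \<in> A \<Longrightarrow> {f x, z} \<in> edges K \<Longrightarrow> z \<noteq> rt K \<Longrightarrow> z \<in> f ` A"
  shows "is_iso f (branch G c) (branch K (f c))"
proof -
  let ?B = "verts (branch G c)" and ?B' = "verts (branch K (f c))"
  have c: "c \<in> A" using B by (auto simp: branch_sel)
  have "f v \<in> ?B'" if "v \<in> ?B" for v
  proof -
    have "(c, v) \<in> (adj {f \<in> edges G. rt G \<notin> f})\<^sup>*" using that by (simp add: branch_sel)
    then have "v \<in> A \<and> f v \<in> ?B'"
    proof induct
      case base
      then show ?case using c by (simp add: branch_sel)
    next
      case (step x y)
      have "y \<in> ?B" using step by (auto simp: branch_sel intro: rtrancl_into_rtrancl)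
      then have "y \<in> A" using B by blast
      then show ?case using step branch_closed[of "f x" K "f c" "f y"] e[of x y] nrt
        by (auto simp: adj_iff)
    qed
    then show ?thesis by simp
  qed
  moreover have "w \<in> f ` ?B" if "w \<in> ?B'" for w
  proof -
    have "(f c, w) \<in> (adj {f \<in> edges K. rt K \<notin> f})\<^sup>*" using that by (simp add: branch_sel)
    then show ?thesis
    proof induct
      case base
      then show ?case by (auto simp: branch_sel)
    next
      case (step x y)
      then obtain u where u: "u \<in> ?B" "x = f u" by blast
      have xy: "{f u, y} \<in> edges K" "y \<noteq> rt K" using step u by (auto simp: adj_iff)
      then obtain z where z: "z \<in> A" "y = f z" using out[of u y] u B by blast
      then have "z \<in> ?B" using branch_closed[OF u(1), of z] e[of u z] u B nrt[of u] nrt[of z] xy by auto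
      then show ?case using z by blast
    qed
  qed
  ultimately have im: "f ` ?B = ?B'" by blast
  have bij: "bij_betw f ?B ?B'" using im inj B by (auto simp: bij_betw_def intro: inj_on_subset)
  have "{x, y} \<in> edges (branch G c) \<longleftrightarrow> {f x, f y} \<in> edges (branch K (f c))"
    if "x \<in> ?B" "y \<in> ?B" for x y
    using that e[of x y] B im by (auto simp: branch_sel(2))
  then show ?thesis using bij by (auto simp: is_iso_def branch_sel(3))
qed

text \<open>Recognises the powers of the variable \<open>S\<close> when trees are read as monomials in their root branches.\<close>

definition branches_all :: "'w rgraph \<Rightarrow> 'v rgraph \<Rightarrow> bool" where
  "branches_all S G \<longleftrightarrow> (\<forall>c\<in>root_children G. branch G c \<cong>\<^sub>r S)"

lemma branches_all_iso:
  assumes i: "is_iso \<phi> G H" and G: "rooted_tree G" and H: "rooted_tree H" and a: "branches_all S H"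
  shows "branches_all S G"
  unfolding branches_all_def
proof
  fix c assume c: "c \<in> root_children G"
  have lf: "loopfree G" "loopfree H" "rt G \<in> verts G"
    using G H by (auto simp: rooted_tree_altdef)
  have cv: "c \<in> verts G" "c \<noteq> rt G" using c root_children_verts[OF lf(1)] by auto
  have inj: "inj_on \<phi> (verts G)" and im: "\<phi> ` verts G = verts H" and r: "\<phi> (rt G) = rt H"
    using i by (auto simp: is_iso_def bij_betw_def)
  have "is_iso \<phi> (branch G c) (branch H (\<phi> c))"
  proof (rule branch_transport[where A = "verts G - {rt G}"])
    show "verts (branch G c) \<subseteq> verts G - {rt G}" by (rule branch_verts[OF lf(1) cv])
    show "inj_on \<phi> (verts G - {rt G})" using inj by (rule inj_on_subset) auto
    show "{x, y} \<in> edges G \<longleftrightarrow> {\<phi> x, \<phi> y} \<in> edges H" if "x \<in> verts G - {rt G}" "y \<in> verts G - {rt G}" for x y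
      using i that by (auto simp: is_iso_def)
    show "x \<noteq> rt G \<and> \<phi> x \<noteq> rt H" if "x \<in> verts G - {rt G}" for x
      using inj that lf(3) r by (metis DiffE inj_onD singletonI)
    show "z \<in> \<phi> ` (verts G - {rt G})" if "{\<phi> x, z} \<in> edges H" "z \<noteq> rt H" for x z
    proof -
      have "z \<in> \<phi> ` verts G" using loopfreeD[OF lf(2) that(1)] im by blast
      then show ?thesis using that(2) r by blast
    qed
  qed
  then have "branch G c \<cong>\<^sub>r branch H (\<phi> c)" by (auto simp: rgraph_iso_iff)
  moreover have "branch H (\<phi> c) \<cong>\<^sub>r S"
    using a c root_children_iso[OF i lf] by (auto simp: branches_all_def)
  ultimately show "branch G c \<cong>\<^sub>r S" by (rule rgraph_iso_trans)
qed

lemma branch_graft_old: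
  assumes G: "rooted_tree G" and c: "c \<in> root_children G"
  shows "is_iso Inl (branch G c) (branch (graft G (rt G) H) (Inl c))"
proof -
  have lf: "loopfree G" using G by (simp add: rooted_tree_altdef)
  have cv: "c \<in> verts G" "c \<noteq> rt G" using c root_children_verts[OF lf(1)] by auto
  show ?thesis
  proof (rule branch_transport[where A = "verts G - {rt G}"])
    show "verts (branch G c) \<subseteq> verts G - {rt G}" by (rule branch_verts[OF lf(1) cv])
    show "z \<in> Inl ` (verts G - {rt G})"
      if "x \<in> verts G - {rt G}" "{Inl x, z} \<in> edges (graft G (rt G) H)" "z \<noteq> rt (graft G (rt G) H)" for x z
      using that loopfreeD[OF lf, of x] by (cases z) auto
  qed auto
qed

lemma branch_graft_new:
  assumes H: "rooted_tree H"
  shows "is_iso Inr H (branch (graft G (rt G) H) (Inr (rt H)))"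
proof -
  let ?K = "graft G (rt G) H"
  have lf: "loopfree H" "rt H \<in> verts H" using H by (auto simp: rooted_tree_altdef)
  let ?B = "verts (branch ?K (Inr (rt H)))"
  have "Inr x \<in> ?B" if "x \<in> verts H" for x
  proof -
    have "(Inr (rt H), Inr x) \<in> (adj {f \<in> edges ?K. rt ?K \<notin> f})\<^sup>*"
    proof (rule rtrancl_image[where f = Inr and r = "adj (edges H)"])
      show "(rt H, x) \<in> (adj (edges H))\<^sup>*"
        using H that by (simp add: rooted_tree_altdef connected_graph_def)
    qed (simp add: adj_iff)
    then show ?thesis by (simp add: branch_sel)
  qed
  moreover have "z \<in> Inr ` verts H" if "z \<in> ?B" for z
  proof -
    have "(Inr (rt H), z) \<in> (adj {f \<in> edges ?K. rt ?K \<notin> f})\<^sup>*" using that by (simp add: branch_sel)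
    then show ?thesis
    proof induct
      case (step y z)
      then show ?case using loopfreeD[OF lf(1)] by (cases z) (auto simp: adj_iff)
    qed (use lf in simp)
  qed
  ultimately have im: "Inr ` verts H = ?B" by blast
  have "bij_betw Inr (verts H) ?B" using im by (simp add: bij_betw_def)
  moreover have "{x, y} \<in> edges H \<longleftrightarrow> {Inr x, Inr y} \<in> edges (branch ?K (Inr (rt H)))"
    if "x \<in> verts H" "y \<in> verts H" for x y
    using that im by (auto simp: branch_sel(2))
  ultimately show ?thesis by (auto simp: is_iso_def branch_sel(3))
qed

text \<open>The branches of a graft at the root are the branches of \<open>G\<close> and \<open>H\<close> itself.\<close>

lemma branches_all_graft:
  assumes G: "rooted_tree G" and H: "rooted_tree H"
  shows "branches_all S (graft G (rt G) H) \<longleftrightarrow> branches_all S G \<and> H \<cong>\<^sub>r S"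
proof -
  have *: "A \<cong>\<^sub>r S \<longleftrightarrow> B \<cong>\<^sub>r S" if "is_iso f A B" "rt A \<in> verts A" for A :: "'x rgraph" and B :: "'y rgraph" and f
    using that rgraph_iso_trans rgraph_iso_sym rgraph_iso_iff by metis
  have 1: "branch (graft G (rt G) H) (Inl c) \<cong>\<^sub>r S \<longleftrightarrow> branch G c \<cong>\<^sub>r S" if "c \<in> root_children G" for c
    using *[OF branch_graft_old[OF G that, where H = H]] by (simp add: branch_sel)
  have 2: "branch (graft G (rt G) H) (Inr (rt H)) \<cong>\<^sub>r S \<longleftrightarrow> H \<cong>\<^sub>r S"
    using *[OF branch_graft_new[OF H, where G = G]] H by (simp add: rooted_tree_altdef)
  show ?thesis
    by (auto simp: branches_all_def root_children_graft 1 2)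
qed

section \<open>Grafting at the root on isomorphism classes\<close>

text \<open>The chosen class exists and is unique by \<open>join_iso\<close> and \<open>rtree_eqI\<close>.\<close>

definition join :: "rtree \<Rightarrow> rtree \<Rightarrow> rtree" where
  "join r s = (SOME t. rep_rtree t \<cong>\<^sub>r graft (rep_rtree r) (rt (rep_rtree r)) (rep_rtree s))"

definition rdeg :: "rtree \<Rightarrow> nat" where
  "rdeg t = card (root_children (rep_rtree t))"

definition copies :: "rtree \<Rightarrow> rtree \<Rightarrow> bool" where
  "copies s t \<longleftrightarrow> branches_all (rep_rtree s) (rep_rtree t)"

lemma rep_verts: "finite (verts (rep_rtree t))" "rt (rep_rtree t) \<in> verts (rep_rtree t)"
  "loopfree (rep_rtree t)" "connected_graph (rep_rtree t)"
  using rooted_tree_rep[of t] by (simp_all add: rooted_tree_altdef)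

lemma graft_rep: "v \<in> verts (rep_rtree r) \<Longrightarrow> rooted_tree (graft (rep_rtree r) v (rep_rtree s))"
  by (rule graft_rooted_tree[OF rooted_tree_rep rooted_tree_rep])

lemma join_iso: "rep_rtree (join r s) \<cong>\<^sub>r graft (rep_rtree r) (rt (rep_rtree r)) (rep_rtree s)"
  unfolding join_def
  by (rule rtree_of_rooted_tree[OF graft_rep[OF rep_verts(2)]]) (rule someI)

lemma rtree_eqI:
  assumes "rep_rtree s \<cong>\<^sub>r G" "rep_rtree t \<cong>\<^sub>r G"
  shows "s = t"
  unfolding rtree_eq_iff using assms rgraph_iso_sym[OF assms(2) rep_verts(2)] rgraph_iso_trans by blast

lemma rdeg_iso:
  assumes "rep_rtree t \<cong>\<^sub>r G" "loopfree G"
  shows "rdeg t = card (root_children G)"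
proof -
  obtain \<phi> where i: "is_iso \<phi> (rep_rtree t) G" using assms by (auto simp: rgraph_iso_iff)
  have "inj_on \<phi> (root_children (rep_rtree t))"
    using i root_children_verts[OF rep_verts(3)[of t]]
    by (auto simp: is_iso_def bij_betw_def intro: inj_on_subset)
  then show ?thesis
    using root_children_iso[OF i rep_verts(3) assms(2) rep_verts(2)] by (simp add: rdeg_def card_image)
qed

lemma finite_root_children: "finite (root_children (rep_rtree t))"
  using root_children_verts[OF rep_verts(3)[of t]] rep_verts(1)[of t] finite_subset by blast

lemma rdeg_graft:
  assumes "rep_rtree t \<cong>\<^sub>r graft (rep_rtree r) v (rep_rtree s)" "v \<in> verts (rep_rtree r)"
  shows "rdeg t = rdeg r + (if v = rt (rep_rtree r) then 1 else 0)"
proof -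
  have "loopfree (graft (rep_rtree r) v (rep_rtree s))"
    using graft_rep[OF assms(2)] by (simp add: rooted_tree_altdef)
  from rdeg_iso[OF assms(1) this] show ?thesis
    by (auto simp: root_children_graft card_insert_if finite_root_children card_image rdeg_def)
qed

lemma rdeg_join [simp]: "rdeg (join r s) = Suc (rdeg r)"
  using rdeg_graft[OF join_iso rep_verts(2)] by simp

text \<open>The leading-term principle of the whole proof: among the trees obtained by grafting \<open>s\<close> on \<open>r\<close>, the
  graft at the root is the only one with more root branches than \<open>r\<close>.\<close>

lemma beta_nonzero_cases:
  assumes "beta t s r \<noteq> 0"
  shows "t = join r s \<or> rdeg t = rdeg r"
proof -
  obtain v where v: "v \<in> verts (rep_rtree r)" "rep_rtree t \<cong>\<^sub>r graft (rep_rtree r) v (rep_rtree s)"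
    using card_Collect_nonzero[OF assms[unfolded beta_def]] by blast
  show ?thesis
  proof (cases "v = rt (rep_rtree r)")
    case True
    then show ?thesis using rtree_eqI[OF _ join_iso] v by blast
  next
    case False
    then show ?thesis using rdeg_graft[OF v(2,1)] by simp
  qed
qed

lemma beta_join: "beta (join r s) s r \<noteq> 0"
proof -
  have "rt (rep_rtree r) \<in> {v \<in> verts (rep_rtree r). rep_rtree (join r s) \<cong>\<^sub>r graft (rep_rtree r) v (rep_rtree s)}"
    using join_iso rep_verts(2) by simp
  then show ?thesis
    unfolding beta_def using rep_verts(1)[of r] by (auto simp: card_eq_0_iff)
qed

lemma tsize_join: "tsize (join r s) = tsize s + tsize r"
  by (rule beta_nonzero_size[OF beta_join])

lemma tsize_pos: "tsize t > 0"
  using rep_verts[of t] by (auto simp: tsize_def card_gt_0_iff)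

lemma rdeg_less_tsize: "rdeg t < tsize t"
proof -
  have "root_children (rep_rtree t) \<subset> verts (rep_rtree t)"
    using root_children_verts[OF rep_verts(3)[of t]] rep_verts(2)[of t] by blast
  then show ?thesis unfolding rdeg_def tsize_def by (rule psubset_card_mono[OF rep_verts(1)])
qed

text \<open>Any edge at the root can be cut.\<close>

lemma tree_is_join:
  assumes "tsize t \<noteq> 1"
  obtains r s where "t = join r s"
proof -
  let ?G = "rep_rtree t"
  note G = rooted_tree_rep[of t]
  have "verts ?G \<noteq> {rt ?G}" using assms by (auto simp: tsize_def)
  then obtain x where x: "x \<in> verts ?G" "x \<noteq> rt ?G" using rep_verts(2)[of t] by blast
  have "(rt ?G, x) \<in> (adj (edges ?G))\<^sup>*"
    using rep_verts[of t] x by (simp add: connected_graph_def)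
  then obtain c where c: "{rt ?G, c} \<in> edges ?G"
    using x by (metis adj_iff converse_rtranclE)
  let ?e = "{rt ?G, c}"
  obtain a b where ab: "?e = {a, b}" and cut: "cuts ?G (root_side ?G ?e) (verts ?G - root_side ?G ?e) a b"
    using tree_edge_cuts[OF G c] by blast
  have "rt ?G \<noteq> b" using cut by (auto simp: cuts_def)
  then have a: "rt ?G = a" using ab by (auto simp: doubleton_eq_iff)
  obtain r where r: "rep_rtree r \<cong>\<^sub>r cut_R ?G ?e"
    using rtree_of_rooted_tree[OF cut_rooted(1)[OF G c]] .
  obtain s where s: "rep_rtree s \<cong>\<^sub>r cut_P ?G ?e"
    using rtree_of_rooted_tree[OF cut_rooted(2)[OF G c]] .
  obtain \<psi>1 \<psi>2 where p: "is_iso \<psi>1 (rep_rtree r) (cut_R ?G {a, b})" "is_iso \<psi>2 (rep_rtree s) (cut_P ?G {a, b})"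
    using r s ab by (auto simp: rgraph_iso_iff)
  have "\<psi>1 (rt (rep_rtree r)) = a"
    using p(1) a by (simp add: is_iso_def cut_R_def)
  from cuts_graft[OF cut rep_verts(4,3) p rep_verts(2) this rep_verts(2)]
  have i: "graft (rep_rtree r) (rt (rep_rtree r)) (rep_rtree s) \<cong>\<^sub>r ?G"
    by (auto simp: rgraph_iso_iff)
  have "?G \<cong>\<^sub>r graft (rep_rtree r) (rt (rep_rtree r)) (rep_rtree s)"
    by (rule rgraph_iso_sym[OF i]) (simp add: rep_verts InlI)
  from rtree_eqI[OF this join_iso] show thesis by (rule that)
qed

lemma copies_join: "copies t0 (join r s) \<longleftrightarrow> copies t0 r \<and> s = t0"
proof -
  let ?K = "graft (rep_rtree r) (rt (rep_rtree r)) (rep_rtree s)"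
  have K: "rooted_tree ?K" by (rule graft_rep[OF rep_verts(2)])
  have 1: "rep_rtree (join r s) \<cong>\<^sub>r ?K" by (rule join_iso)
  then have 2: "?K \<cong>\<^sub>r rep_rtree (join r s)" by (rule rgraph_iso_sym) (rule rep_verts(2))
  have "copies t0 (join r s) \<longleftrightarrow> branches_all (rep_rtree t0) ?K"
    unfolding copies_def using 1 2 branches_all_iso[OF _ K rooted_tree_rep] branches_all_iso[OF _ rooted_tree_rep K]
    by (auto simp: rgraph_iso_iff)
  then show ?thesis
    by (simp add: branches_all_graft[OF rooted_tree_rep rooted_tree_rep] copies_def rtree_eq_iff)
qed

definition dot :: rtree where
  "dot = (SOME t. tsize t = 1)"

lemma tsize_1_unique:
  assumes "tsize s = 1" "tsize t = 1"
  shows "s = t"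
proof -
  obtain x y where x: "verts (rep_rtree s) = {x}" and y: "verts (rep_rtree t) = {y}"
    using assms unfolding tsize_def by (metis card_1_singletonE)
  have rt: "rt (rep_rtree s) = x" "rt (rep_rtree t) = y"
    using rep_verts(2)[of s] rep_verts(2)[of t] x y by auto
  have "{x, x} \<notin> edges (rep_rtree s)" "{y, y} \<notin> edges (rep_rtree t)"
    using loopfreeD[OF rep_verts(3)] by blast+
  then have "is_iso (\<lambda>_. y) (rep_rtree s) (rep_rtree t)"
    by (simp add: is_iso_def x y rt bij_betw_def)
  then show ?thesis by (auto simp: rtree_eq_iff rgraph_iso_iff)
qed

lemma tsize_dot: "tsize dot = 1"
proof -
  obtain t where "rep_rtree t \<cong>\<^sub>r RGraph {0 :: nat} {} 0"
    using rtree_of_rooted_tree[OF rooted_tree_singleton] .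
  then have "tsize t = 1" using rgraph_iso_card by (fastforce simp: tsize_def)
  then show ?thesis unfolding dot_def by (rule someI)
qed

lemma tsize_1_iff: "tsize t = 1 \<longleftrightarrow> t = dot"
  using tsize_1_unique tsize_dot by blast

lemma rdeg_dot: "rdeg dot = 0"
  using rdeg_less_tsize[of dot] tsize_dot by simp

lemma rdeg_0: "rdeg t = 0 \<Longrightarrow> t = dot"
  by (metis tree_is_join tsize_1_iff rdeg_join nat.distinct(1))

text \<open>The \<open>k\<close>-th power of \<open>s\<close>, when a tree is read as the monomial of its root branches.\<close>

definition bunch :: "rtree \<Rightarrow> nat \<Rightarrow> rtree" where
  "bunch s k = ((\<lambda>r. join r s) ^^ k) dot"

lemma bunch_simps [simp]: "bunch s 0 = dot" "bunch s (Suc k) = join (bunch s k) s"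
  by (simp_all add: bunch_def)

lemma rdeg_bunch [simp]: "rdeg (bunch s k) = k"
  by (induct k) (simp_all add: rdeg_dot)

lemma copies_dot: "copies s dot"
proof -
  have "root_children (rep_rtree dot) = {}"
    using rdeg_dot finite_root_children by (simp add: rdeg_def)
  then show ?thesis by (simp add: copies_def branches_all_def)
qed

lemma copies_bunch: "copies s (bunch s k)"
  by (induct k) (simp_all add: copies_dot copies_join)

text \<open>The branches are removed one at a time until the one-vertex tree is left.\<close>

lemma copies_imp_bunch: "copies s t \<Longrightarrow> t = bunch s (rdeg t)"
proof (induct "rdeg t" arbitrary: t)
  case 0
  then show ?case using rdeg_0 by simp
next
  case (Suc k)
  have "tsize t \<noteq> 1" using Suc(2) rdeg_dot tsize_1_iff[of t] by auto
  then obtain r s' where t: "t = join r s'" by (rule tree_is_join)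
  then show ?case using Suc by (auto simp: copies_join)
qed

text \<open>Unique factorisation for a power: a tree all of whose branches are \<open>t0\<close> arises by attaching \<open>s\<close> to
  the root of \<open>r\<close> only in the obvious way.\<close>

lemma join_eq_bunch:
  assumes "join r s = bunch t0 (Suc k)"
  shows "s = t0 \<and> r = bunch t0 k"
proof -
  have "copies t0 (join r s)" unfolding assms by (rule copies_bunch)
  then have "copies t0 r" "s = t0" by (auto simp: copies_join)
  moreover have "rdeg r = k" using assms by (metis rdeg_bunch rdeg_join nat.inject)
  ultimately show ?thesis using copies_imp_bunch by blast
qed

section \<open>Structure constants and linear maps\<close>

abbreviation lk :: "ie \<Rightarrow> gen \<Rightarrow> complex" where "lk \<equiv> Poly_Mapping.lookup"
abbreviation basis :: "gen \<Rightarrow> ie" where "basis k \<equiv> Poly_Mapping.single k 1"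
abbreviation lin :: "(ie \<Rightarrow> ie) \<Rightarrow> bool" where "lin f \<equiv> Vector_Spaces.linear (*\<^sub>g) (*\<^sub>g) f"

lemma lookup_Sum_any_Dp:
  assumes "finite {r. c r \<noteq> 0}"
  shows "lk (Sum_any (\<lambda>r. c r *\<^sub>g Dp r)) k = (case k of GPlus q \<Rightarrow> c q | _ \<Rightarrow> 0)"
proof -
  have "{r. c r *\<^sub>g Dp r \<noteq> 0} \<subseteq> {r. c r \<noteq> 0}"
    by (auto intro!: poly_mapping_eqI)
  then have "Sum_any (\<lambda>r. c r *\<^sub>g Dp r) = (\<Sum>r\<in>{r. c r \<noteq> 0}. c r *\<^sub>g Dp r)"
    by (rule Sum_any.expand_superset[OF assms])
  then show ?thesis
    using assms by (auto simp: lookup_sum Dp_def lookup_single when_def if_distrib[of "\<lambda>z. _ * z"] sum.delta'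
      split: gen.split cong: if_cong)
qed

lemma lookup_Sum_any_Dm:
  assumes "finite {r. c r \<noteq> 0}"
  shows "lk (Sum_any (\<lambda>r. c r *\<^sub>g Dm r)) k = (case k of GMinus q \<Rightarrow> c q | _ \<Rightarrow> 0)"
proof -
  have "{r. c r *\<^sub>g Dm r \<noteq> 0} \<subseteq> {r. c r \<noteq> 0}"
    by (auto intro!: poly_mapping_eqI)
  then have "Sum_any (\<lambda>r. c r *\<^sub>g Dm r) = (\<Sum>r\<in>{r. c r \<noteq> 0}. c r *\<^sub>g Dm r)"
    by (rule Sum_any.expand_superset[OF assms])
  then show ?thesis
    using assms by (auto simp: lookup_sum Dm_def lookup_single when_def if_distrib[of "\<lambda>z. _ * z"] sum.delta'
      split: gen.split cong: if_cong)
qed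

lemma finite_diff_support:
  fixes c c' :: "rtree \<Rightarrow> nat"
  assumes "finite {r. c r \<noteq> 0}" "finite {r. c' r \<noteq> 0}"
  shows "finite {r. (of_nat (c r) - of_nat (c' r) :: complex) \<noteq> 0}"
  by (rule finite_subset[OF _ finite_UnI[OF assms]]) auto

lemma lookup_plus_plus:
  "lk (gen_bracket (GPlus s) (GPlus t)) k = (case k of GPlus r \<Rightarrow> of_nat (beta r s t) - of_nat (beta r t s) | _ \<Rightarrow> 0)"
  by (simp only: gen_bracket.simps) (intro lookup_Sum_any_Dp finite_diff_support finite_support)

lemma lookup_minus_minus:
  "lk (gen_bracket (GMinus s) (GMinus t)) k = (case k of GMinus r \<Rightarrow> of_nat (alpha t r s) - of_nat (alpha s r t) | _ \<Rightarrow> 0)"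
  by (simp only: gen_bracket.simps) (intro lookup_Sum_any_Dm finite_diff_support finite_support)

lemma alpha_eq_0: "tsize t2 \<le> tsize t1 \<Longrightarrow> alpha t1 t2 r = 0"
  using alpha_nonzero_size[of t1 t2 r] tsize_pos[of r] by (cases "alpha t1 t2 r = 0") auto

lemma beta_eq_0: "tsize t1 \<le> tsize t2 \<Longrightarrow> beta t1 t2 r = 0"
  using beta_nonzero_size[of t1 t2 r] tsize_pos[of r] by (cases "beta t1 t2 r = 0") auto

text \<open>The case \<open>s = t\<close> needs no separate treatment outside \<open>GD\<close>, since \<open>alpha t t r\<close> and \<open>beta t t r\<close> vanish for
  reasons of size.\<close>

lemma lookup_mixed:
  "lk (mixed s t) k = (case k of GD \<Rightarrow> if s = t then 1 else 0
    | GPlus r \<Rightarrow> of_nat (alpha s t r) | GMinus r \<Rightarrow> of_nat (beta s t r))"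
proof -
  have "finite {r. (of_nat (alpha s t r) :: complex) \<noteq> 0}" "finite {r. (of_nat (beta s t r) :: complex) \<noteq> 0}"
    using finite_support by simp_all
  then show ?thesis
    by (auto simp: mixed_def lookup_add lookup_Sum_any_Dp lookup_Sum_any_Dm Dd_def lookup_single when_def
      alpha_eq_0 beta_eq_0 split: gen.split)
qed

lemmas lookup_gen_bracket = lookup_plus_plus lookup_minus_minus
  gen_bracket.simps(3-9) lookup_mixed Dp_def Dm_def lookup_single

primrec weight :: "gen \<Rightarrow> int" where
  "weight GD = 0"
| "weight (GPlus t) = int (tsize t)"
| "weight (GMinus t) = - int (tsize t)"

text \<open>The bracket is graded, because cutting and grafting preserve the number of vertices.\<close>

lemma gen_bracket_weight:
  assumes "lk (gen_bracket a b) k \<noteq> 0"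
  shows "weight k = weight a + weight b"
proof -
  have A: "0 < alpha t1 t2 t3 \<Longrightarrow> int (tsize t2) = int (tsize t1) + int (tsize t3)"
    and B: "0 < beta t1 t2 t3 \<Longrightarrow> int (tsize t1) = int (tsize t2) + int (tsize t3)" for t1 t2 t3
    using alpha_nonzero_size beta_nonzero_size by (metis of_nat_add neq0_conv)+
  have A2: "alpha t r s \<noteq> alpha s r t \<Longrightarrow> int (tsize r) = int (tsize s) + int (tsize t)"
    and B2: "beta r s t \<noteq> beta r t s \<Longrightarrow> int (tsize r) = int (tsize s) + int (tsize t)" for r s t
    using A[of t r s] A[of s r t] B[of r s t] B[of r t s] by linarith+
  show ?thesis
    using assms
    by (cases a; cases b; cases k) (auto simp: lookup_gen_bracket when_def split: if_splits
        simp del: gen_bracket.simps(1,2) dest: A B A2 B2)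
qed

lemma lookup_bracket:
  "lk (bracket x y) k = (\<Sum>a\<in>Poly_Mapping.keys x. \<Sum>b\<in>Poly_Mapping.keys y. lk x a * lk y b * lk (gen_bracket a b) k)"
  by (simp add: bracket_def lookup_sum)

lemma bracket_keyE:
  assumes "k \<in> Poly_Mapping.keys (bracket x y)"
  obtains a b where "a \<in> Poly_Mapping.keys x" "b \<in> Poly_Mapping.keys y" "lk (gen_bracket a b) k \<noteq> 0"
proof -
  have "\<exists>a\<in>Poly_Mapping.keys x. \<exists>b\<in>Poly_Mapping.keys y. lk (gen_bracket a b) k \<noteq> 0"
    using assms unfolding in_keys_iff lookup_bracket by (metis (no_types, lifting) mult_eq_0_iff sum.neutral)
  then show thesis using that by blast
qed

text \<open>Used to read off leading coefficients, where a single pair of basis elements contributes.\<close>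

lemma lookup_bracket_unique:
  assumes "\<And>a b. a \<in> Poly_Mapping.keys x \<Longrightarrow> b \<in> Poly_Mapping.keys y \<Longrightarrow> lk (gen_bracket a b) k \<noteq> 0 \<Longrightarrow> a = a0 \<and> b = b0"
  shows "lk (bracket x y) k = lk x a0 * lk y b0 * lk (gen_bracket a0 b0) k"
proof -
  let ?C = "lk x a0 * lk y b0 * lk (gen_bracket a0 b0) k"
  have inner: "(\<Sum>b\<in>Poly_Mapping.keys y. lk x a * lk y b * lk (gen_bracket a b) k)
      = (if a = a0 then ?C else 0)" if a: "a \<in> Poly_Mapping.keys x" for a
  proof -
    have "(\<Sum>b\<in>Poly_Mapping.keys y. lk x a * lk y b * lk (gen_bracket a b) k)
      = (\<Sum>b\<in>Poly_Mapping.keys y. if b = b0 then (if a = a0 then ?C else 0) else 0)"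
    proof (rule sum.cong[OF refl])
      fix b assume "b \<in> Poly_Mapping.keys y"
      then show "lk x a * lk y b * lk (gen_bracket a b) k = (if b = b0 then (if a = a0 then ?C else 0) else 0)"
        using assms[OF a, of b] by (cases "lk (gen_bracket a b) k = 0") auto
    qed
    also have "\<dots> = (if a = a0 then ?C else 0)"
      by (simp add: sum.delta in_keys_iff)
    finally show ?thesis .
  qed
  have "lk (bracket x y) k = (\<Sum>a\<in>Poly_Mapping.keys x. if a = a0 then ?C else 0)"
    unfolding lookup_bracket by (rule sum.cong[OF refl inner])
  also have "\<dots> = ?C"
    by (simp add: sum.delta in_keys_iff)
  finally show ?thesis .
qed

lemma ie_expand: "x = (\<Sum>k\<in>Poly_Mapping.keys x. lk x k *\<^sub>g basis k)"
  by (rule poly_mapping_eqI)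
    (auto simp: lookup_sum lookup_single when_def in_keys_iff if_distrib[of "\<lambda>z. _ * z"] sum.delta' cong: if_cong)

lemma lin_expand:
  assumes "lin f"
  shows "f x = (\<Sum>k\<in>Poly_Mapping.keys x. lk x k *\<^sub>g f (basis k))"
proof -
  interpret f: Vector_Spaces.linear "(*\<^sub>g)" "(*\<^sub>g)" f by (rule assms)
  show ?thesis by (subst ie_expand[of x]) (simp only: f.sum f.scale)
qed

lemma lin_eqI:
  assumes "lin f" "lin g" "\<And>k. f (basis k) = g (basis k)"
  shows "f = g"
proof
  show "f x = g x" for x
    by (simp add: lin_expand[OF assms(1), of x] lin_expand[OF assms(2), of x] assms(3))
qed

lemma bracket_scale: "bracket (c *\<^sub>g u) (d *\<^sub>g v) = (c * d) *\<^sub>g bracket u v"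
proof -
  interpret A: Vector_Spaces.linear "(*\<^sub>g)" "(*\<^sub>g)" "bracket (c *\<^sub>g u)" by (rule bracket_bilinear(1))
  interpret B: Vector_Spaces.linear "(*\<^sub>g)" "(*\<^sub>g)" "\<lambda>x. bracket x v" by (rule bracket_bilinear(2))
  show ?thesis by (rule poly_mapping_eqI) (simp add: A.scale B.scale)
qed

lemma lin_bracketI:
  assumes f: "lin f" and b: "\<And>a b. f (gen_bracket a b) = bracket (f (basis a)) (f (basis b))"
  shows "f (bracket x y) = bracket (f x) (f y)"
proof -
  interpret f: Vector_Spaces.linear "(*\<^sub>g)" "(*\<^sub>g)" f by (rule f)
  have l: "lin (\<lambda>x. f (bracket x y))" "lin (\<lambda>x. bracket (f x) (f y))" for y
    using Vector_Spaces.linear_compose[OF bracket_bilinear(2) f] Vector_Spaces.linear_compose[OF f bracket_bilinear(2)]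
    by (simp_all add: o_def)
  have r: "lin (\<lambda>y. f (bracket x y))" "lin (\<lambda>y. bracket (f x) (f y))" for x
    using Vector_Spaces.linear_compose[OF bracket_bilinear(1) f] Vector_Spaces.linear_compose[OF f bracket_bilinear(1)]
    by (simp_all add: o_def)
  have left: "f (bracket (basis a) y) = bracket (f (basis a)) (f y)" for a y
    by (rule fun_cong[OF lin_eqI[OF r]]) (simp add: bracket_single b)
  show ?thesis
    by (rule fun_cong[OF lin_eqI[OF l]]) (rule left)
qed

section \<open>The automorphisms given by the grading and by duality\<close>

text \<open>Linear maps that permute the basis up to scalars. Below, \<open>p\<close> is always an involution.\<close>

definition monomial_map :: "(gen \<Rightarrow> gen) \<Rightarrow> (gen \<Rightarrow> complex) \<Rightarrow> ie \<Rightarrow> ie" where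
  "monomial_map p w x = (\<Sum>k\<in>Poly_Mapping.keys x. (lk x k * w k) *\<^sub>g basis (p k))"

lemma lookup_monomial_map:
  assumes "\<And>k. p (p k) = k"
  shows "lk (monomial_map p w x) k = w (p k) * lk x (p k)"
proof -
  have "p j = k \<longleftrightarrow> j = p k" for j k using assms by metis
  then show ?thesis
    by (auto simp: monomial_map_def lookup_sum lookup_single when_def in_keys_iff
      if_distrib[of "\<lambda>z. _ * z"] sum.delta sum.delta' cong: if_cong)
qed

lemma monomial_map_basis: "monomial_map p w (basis k) = w k *\<^sub>g basis (p k)"
  by (simp add: monomial_map_def)

text \<open>It suffices to compare structure constants, because both sides of the homomorphism rule are bilinear.\<close>

lemma monomial_map_aut:
  assumes p: "\<And>k. p (p k) = k" and w: "\<And>k. w k \<noteq> 0"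
    and g: "\<And>a b k. w k * lk (gen_bracket a b) k = w a * w b * lk (gen_bracket (p a) (p b)) (p k)"
  shows "is_ie_aut (monomial_map p w)"
proof -
  let ?F = "monomial_map p w" and ?G = "monomial_map p (\<lambda>k. 1 / w (p k))"
  have lin: "lin ?F"
    unfolding Vector_Spaces.linear_iff
    by (auto intro!: poly_mapping_eqI simp: vector_space_ie lookup_monomial_map[OF p] lookup_add algebra_simps)
  have "?F \<circ> ?G = id" "?G \<circ> ?F = id"
    by (auto intro!: ext poly_mapping_eqI simp: lookup_monomial_map p w)
  then have "bij ?F" by (metis o_bij)
  moreover have "?F (bracket x y) = bracket (?F x) (?F y)" for x y
  proof (rule lin_bracketI[OF lin])
    fix a b
    show "?F (gen_bracket a b) = bracket (?F (basis a)) (?F (basis b))"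
    proof (rule poly_mapping_eqI)
      fix k
      show "lk (?F (gen_bracket a b)) k = lk (bracket (?F (basis a)) (?F (basis b))) k"
        using g[of "p k" a b] by (simp add: monomial_map_basis bracket_scale bracket_single lookup_monomial_map[OF p] p)
    qed
  qed
  ultimately show ?thesis using lin by (simp add: is_ie_aut_def)
qed

definition tau :: "complex \<Rightarrow> ie \<Rightarrow> ie" where
  "tau c = monomial_map id (\<lambda>k. c powi weight k)"

lemma lookup_tau: "lk (tau c x) k = c powi weight k * lk x k"
  by (simp add: tau_def lookup_monomial_map)

lemma tau_aut: "c \<noteq> 0 \<Longrightarrow> is_ie_aut (tau c)"
  unfolding tau_def
proof (rule monomial_map_aut)
  fix a b k assume "c \<noteq> 0"
  then show "c powi weight k * lk (gen_bracket a b) k = c powi weight a * c powi weight b * lk (gen_bracket (id a) (id b)) (id k)"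
    using gen_bracket_weight[of a b k] by (cases "lk (gen_bracket a b) k = 0") (simp_all add: power_int_add)
qed auto

lemma tau_minus_one_eq: "tau_minus_one = tau (-1)"
proof
  have "tau_weight k = (-1) powi weight k" for k
    by (cases k) simp_all
  then show "tau_minus_one x = tau (-1) x" for x
    by (intro poly_mapping_eqI) (simp add: lookup_tau lookup_tau_minus_one)
qed

primrec flip :: "gen \<Rightarrow> gen" where
  "flip GD = GD" | "flip (GPlus t) = GMinus t" | "flip (GMinus t) = GPlus t"

text \<open>The sizes of these scalars make the factors in \<open>beta_sigma\<close> cancel. Those of \<open>D\<^sub>t\<^sup>+\<close> and \<open>D\<^sub>t\<^sup>-\<close> have product
  \<open>1\<close>, which with the exchange of the two arguments of \<open>[D\<^sub>t\<^sup>-, D\<^sub>t\<^sup>+] = d\<close> forces the sign at \<open>d\<close>.\<close>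

primrec flip_weight :: "gen \<Rightarrow> complex" where
  "flip_weight GD = -1"
| "flip_weight (GPlus t) = - of_nat (sigma t)"
| "flip_weight (GMinus t) = - 1 / of_nat (sigma t)"

definition omega :: "ie \<Rightarrow> ie" where
  "omega = monomial_map flip flip_weight"

lemma flip_flip [simp]: "flip (flip k) = k"
  by (cases k) simp_all

lemma flip_weight_nonzero: "flip_weight k \<noteq> 0"
  using sigma_pos by (cases k) (simp_all add: neq0_conv)

text \<open>In every case \<open>beta_sigma\<close> expresses the numbers \<open>beta\<close> through \<open>alpha\<close>, and the factors \<open>sigma\<close> cancel.\<close>

lemma omega_aut: "is_ie_aut omega"
  unfolding omega_def
proof (rule monomial_map_aut[OF flip_flip flip_weight_nonzero])
  fix a b k
  have ab: "of_nat (beta r s t) * of_nat (sigma r) = (of_nat (alpha s r t) * of_nat (sigma s) * of_nat (sigma t) :: complex)" for r s t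
    by (metis beta_sigma of_nat_mult)
  have nz: "sigma t \<noteq> 0" for t
    using sigma_pos[of t] by simp
  have B: "of_nat (beta r s t) = (of_nat (alpha s r t) * of_nat (sigma s) * of_nat (sigma t) / of_nat (sigma r) :: complex)" for r s t
    using ab[of r s t] nz by (simp add: field_simps)
  show "flip_weight k * lk (gen_bracket a b) k = flip_weight a * flip_weight b * lk (gen_bracket (flip a) (flip b)) (flip k)"
    by (cases a; cases b; cases k)
      (simp_all add: lookup_gen_bracket when_def B nz field_simps del: gen_bracket.simps(1,2))
qed

lemma lookup_omega: "lk (omega x) k = flip_weight (flip k) * lk x (flip k)"
  by (simp add: omega_def lookup_monomial_map)

lemma omega_basis: "omega (basis k) = flip_weight k *\<^sub>g basis (flip k)"
  by (simp add: omega_def monomial_map_basis)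

section \<open>Automorphisms act on d by a sign\<close>

lemma lookup_bracket_Dd: "lk (bracket Dd y) k = of_int (weight k) * lk y k"
proof -
  have g: "lk (gen_bracket GD b) k \<noteq> 0 \<Longrightarrow> b = k" for b
    by (cases b; cases k) (auto simp: lookup_gen_bracket when_def split: if_splits)
  have "lk (bracket Dd y) k = lk Dd GD * lk y k * lk (gen_bracket GD k) k"
    by (rule lookup_bracket_unique) (use g in \<open>auto simp: Dd_def\<close>)
  also have "lk (gen_bracket GD k) k = of_int (weight k)"
    by (cases k) (simp_all add: lookup_gen_bracket)
  finally show ?thesis by (simp add: Dd_def)
qed

lemma autD:
  assumes "is_ie_aut f"
  shows "lin f" "bij f" "f (bracket x y) = bracket (f x) (f y)" "f 0 = 0"
    "f (x + y) = f x + f y" "f (x - y) = f x - f y" "f (c *\<^sub>g x) = c *\<^sub>g f x" "f x = f y \<longleftrightarrow> x = y"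
proof -
  show l: "lin f" and b: "bij f" and "f (bracket x y) = bracket (f x) (f y)"
    using assms by (auto simp: is_ie_aut_def)
  interpret f: Vector_Spaces.linear "(*\<^sub>g)" "(*\<^sub>g)" f by (rule l)
  show "f 0 = 0" "f (x + y) = f x + f y" "f (x - y) = f x - f y" "f (c *\<^sub>g x) = c *\<^sub>g f x"
    by (rule f.zero, rule f.add, rule f.diff, rule f.scale)
  show "f x = f y \<longleftrightarrow> x = y" using b by (simp add: bij_is_inj inj_eq)
qed

lemma aut_comp: "is_ie_aut f \<Longrightarrow> is_ie_aut g \<Longrightarrow> is_ie_aut (f \<circ> g)"
  by (auto simp: is_ie_aut_def bij_comp Vector_Spaces.linear_compose)

lemma aut_inv: "is_ie_aut f \<Longrightarrow> is_ie_aut (inv_into UNIV f)"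
proof -
  assume f: "is_ie_aut f"
  interpret group Aut_ie by (rule group_Aut_ie)
  have fc: "f \<in> carrier Aut_ie" using f by (simp add: Aut_ie_def)
  obtain g where g: "g \<in> carrier Aut_ie" "f \<circ> g = id"
    using r_inv_ex[OF fc] by (auto simp: Aut_ie_def)
  have "inv_into UNIV f = g"
  proof
    fix x
    have "f (g x) = x" using fun_cong[OF g(2), of x] by simp
    then show "inv_into UNIV f x = g x" using autD(2)[OF f] by (metis bij_is_inj inv_f_f)
  qed
  then show ?thesis using g(1) by (simp add: Aut_ie_def)
qed

text \<open>Local finiteness of \<open>ad (f d)\<close> is transported from \<open>ad d\<close>, which is diagonal in the given basis.\<close>

lemma locally_finite:
  assumes f: "is_ie_aut f"
  shows "\<exists>F. finite F \<and> (\<forall>k. Poly_Mapping.keys (((bracket (f Dd)) ^^ k) y) \<subseteq> F)"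
proof -
  obtain z where z: "y = f z" using autD(2)[OF f] by (metis bij_is_surj surjD)
  let ?z = "\<lambda>k. ((bracket Dd) ^^ k) z"
  have 1: "((bracket (f Dd)) ^^ k) y = f (?z k)" for k
    by (induct k) (simp_all add: z autD(3)[OF f])
  have 2: "Poly_Mapping.keys (?z k) \<subseteq> Poly_Mapping.keys z" for k
  proof (induct k)
    case (Suc k)
    have "Poly_Mapping.keys (bracket Dd (?z k)) \<subseteq> Poly_Mapping.keys (?z k)"
      by (auto simp: in_keys_iff lookup_bracket_Dd)
    then show ?case using Suc by simp
  qed simp
  let ?F = "\<Union>a\<in>Poly_Mapping.keys z. Poly_Mapping.keys (f (basis a))"
  have "Poly_Mapping.keys (f (?z k)) \<subseteq> ?F" for k
  proof
    fix j assume j: "j \<in> Poly_Mapping.keys (f (?z k))"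
    have "\<exists>a\<in>Poly_Mapping.keys (?z k). lk (f (basis a)) j \<noteq> 0"
    proof (rule ccontr)
      assume "\<not> ?thesis"
      then have "lk (f (?z k)) j = 0"
        by (subst lin_expand[OF autD(1)[OF f]]) (simp add: lookup_sum)
      then show False using j by (simp add: in_keys_iff)
    qed
    then show "j \<in> ?F" using 2[of k] by (auto simp: in_keys_iff)
  qed
  then show ?thesis unfolding 1 by (intro exI[of _ ?F]) simp
qed

lemma beta_rdeg_le: "beta q t t' \<noteq> 0 \<Longrightarrow> rdeg q \<le> Suc (rdeg t')"
  using beta_nonzero_cases[of q t t'] by auto

text \<open>Iterated brackets are controlled through their top degree, and there through the number of root
  branches. The start has \<open>tsize t0\<close> branches so that every tree of \<open>x\<close> of that size has fewer root branches
  than the tree it meets. Hence the term of the bracket in which the iterate is grafted onto a tree of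
  \<open>x\<close> never reaches the top, and the coefficient at the next power of \<open>t0\<close> comes from the previous power alone.\<close>

lemma not_locally_finite:
  assumes t0: "lk x (GPlus t0) \<noteq> 0" and N: "\<And>t. lk x (GPlus t) \<noteq> 0 \<Longrightarrow> tsize t \<le> tsize t0"
  shows "lk (((bracket x) ^^ k) (Dp (bunch t0 (tsize t0)))) (GPlus (bunch t0 (tsize t0 + k))) \<noteq> 0"
proof -
  let ?N = "tsize t0" and ?y = "\<lambda>k. ((bracket x) ^^ k) (Dp (bunch t0 (tsize t0)))"
  let ?u = "\<lambda>k. bunch t0 (tsize t0 + k)"
  have xw: "weight a \<le> int ?N" if "a \<in> Poly_Mapping.keys x" for a
    using that N by (cases a) (auto simp: in_keys_iff)
  have xd: "rdeg t < ?N" if "GPlus t \<in> Poly_Mapping.keys x" for t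
    using that N[of t] rdeg_less_tsize[of t] by (simp add: in_keys_iff)
  have usize: "int (tsize (?u (Suc k))) = int ?N + int (tsize (?u k))" for k
    by (simp add: tsize_join)
  have "(\<forall>a\<in>Poly_Mapping.keys (?y k). weight a \<le> int (tsize (?u k))) \<and>
    (\<forall>q. GPlus q \<in> Poly_Mapping.keys (?y k) \<longrightarrow> tsize q = tsize (?u k) \<longrightarrow> rdeg q \<le> ?N + k) \<and>
    lk (?y k) (GPlus (?u k)) \<noteq> 0" for k
  proof (induct k)
    case 0
    then show ?case by (simp add: Dp_def)
  next
    case (Suc k)
    let ?z = "?y k"
    \<comment> \<open>top degree is reached only if both factors have top degree\<close>
    have top: "\<exists>t t'. a = GPlus t \<and> b = GPlus t' \<and> tsize t = ?N \<and> tsize t' = tsize (?u k) \<and> rdeg t < ?N \<and> rdeg t' \<le> ?N + k"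
      if a: "a \<in> Poly_Mapping.keys x" and b: "b \<in> Poly_Mapping.keys ?z" and w: "weight a + weight b = int (tsize (?u (Suc k)))" for a b
    proof -
      have "weight a \<le> int ?N" "weight b \<le> int (tsize (?u k))" using xw[OF a] Suc b by auto
      then have wa: "weight a = int ?N" and wb: "weight b = int (tsize (?u k))"
        using w usize[of k] by linarith+
      obtain t where t: "a = GPlus t" using wa tsize_pos[of t0] by (cases a) auto
      obtain t' where t': "b = GPlus t'" using wb tsize_pos[of "?u k"] by (cases b) auto
      show ?thesis using t t' wa wb xd[of t] a b Suc by auto
    qed
    \<comment> \<open>the only contribution to the next power of \<open>t0\<close> attaches \<open>t0\<close> to the root of the previous one\<close>
    have uniq: "a = GPlus t0 \<and> b = GPlus (?u k)"
      if a: "a \<in> Poly_Mapping.keys x" and b: "b \<in> Poly_Mapping.keys ?z"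
        and nz: "lk (gen_bracket a b) (GPlus (?u (Suc k))) \<noteq> 0" for a b
    proof -
      have "weight a + weight b = int (tsize (?u (Suc k)))" using gen_bracket_weight[OF nz] by simp
      from top[OF a b this] obtain t t' where t: "a = GPlus t" "b = GPlus t'" "rdeg t < ?N" "rdeg t' \<le> ?N + k" by blast
      \<comment> \<open>grafting on \<open>t\<close>, which has few root branches, cannot give so many of them\<close>
      have "beta (?u (Suc k)) t' t = 0"
        using beta_rdeg_le[of "?u (Suc k)" t' t] t(3) by (cases "beta (?u (Suc k)) t' t = 0") auto
      then have "beta (?u (Suc k)) t t' \<noteq> 0"
        using nz t by (auto simp: lookup_gen_bracket simp del: gen_bracket.simps(1,2) bunch_simps)
      then have "join t' t = bunch t0 (Suc (?N + k))"
        using beta_nonzero_cases[of "?u (Suc k)" t t'] t(4) by auto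
      from join_eq_bunch[OF this] show ?thesis using t by simp
    qed
    have "lk (?y (Suc k)) (GPlus (?u (Suc k))) =
        lk x (GPlus t0) * lk ?z (GPlus (?u k)) * lk (gen_bracket (GPlus t0) (GPlus (?u k))) (GPlus (?u (Suc k)))"
      unfolding funpow.simps o_apply by (rule lookup_bracket_unique) (rule uniq)
    moreover have "lk (gen_bracket (GPlus t0) (GPlus (?u k))) (GPlus (?u (Suc k))) \<noteq> 0"
    proof -
      have "beta (?u (Suc k)) (?u k) t0 = 0"
        using beta_rdeg_le[of "?u (Suc k)" "?u k" t0] rdeg_less_tsize[of t0]
        by (cases "beta (?u (Suc k)) (?u k) t0 = 0") auto
      then show ?thesis using beta_join[of "?u k" t0]
        by (simp add: lookup_gen_bracket del: gen_bracket.simps(1,2))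
    qed
    ultimately have 3: "lk (?y (Suc k)) (GPlus (?u (Suc k))) \<noteq> 0"
      using t0 Suc by simp
    have 1: "weight j \<le> int (tsize (?u (Suc k)))" if j: "j \<in> Poly_Mapping.keys (?y (Suc k))" for j
    proof -
      obtain a b where ab: "a \<in> Poly_Mapping.keys x" "b \<in> Poly_Mapping.keys ?z" "lk (gen_bracket a b) j \<noteq> 0"
        using j unfolding funpow.simps o_apply by (rule bracket_keyE)
      have "weight b \<le> int (tsize (?u k))" using Suc ab by blast
      then show ?thesis using gen_bracket_weight[OF ab(3)] xw[OF ab(1)] usize[of k] by linarith
    qed
    have 2: "rdeg q \<le> ?N + Suc k" if q: "GPlus q \<in> Poly_Mapping.keys (?y (Suc k))" "tsize q = tsize (?u (Suc k))" for q
    proof -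
      obtain a b where ab: "a \<in> Poly_Mapping.keys x" "b \<in> Poly_Mapping.keys ?z" "lk (gen_bracket a b) (GPlus q) \<noteq> 0"
        using q(1) unfolding funpow.simps o_apply by (rule bracket_keyE)
      have "weight a + weight b = int (tsize (?u (Suc k)))" using gen_bracket_weight[OF ab(3)] q(2) by simp
      from top[OF ab(1,2) this] obtain t t' where t: "a = GPlus t" "b = GPlus t'" "rdeg t < ?N" "rdeg t' \<le> ?N + k" by blast
      have "beta q t t' \<noteq> 0 \<or> beta q t' t \<noteq> 0"
        using ab(3) t by (auto simp: lookup_gen_bracket simp del: gen_bracket.simps(1,2))
      then show ?thesis using beta_rdeg_le[of q t t'] beta_rdeg_le[of q t' t] t by linarith
    qed
    show ?case using 1 2 3 by blast
  qed
  then show ?thesis by blast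
qed

text \<open>Otherwise, for \<open>t0\<close> of maximal size, infinitely many powers of \<open>t0\<close> would have to lie in one finite set.\<close>

lemma aut_Dd_no_plus:
  assumes f: "is_ie_aut f"
  shows "lk (f Dd) (GPlus t) = 0"
proof (rule ccontr)
  assume nz: "lk (f Dd) (GPlus t) \<noteq> 0"
  let ?T = "{t. lk (f Dd) (GPlus t) \<noteq> 0}"
  have fin: "finite ?T"
    using finite_vimageI[OF finite_keys[of "f Dd"], of GPlus] by (auto simp: inj_def vimage_def in_keys_iff)
  obtain t0 where t0: "t0 \<in> ?T" "\<And>t. t \<in> ?T \<Longrightarrow> tsize t \<le> tsize t0"
  proof -
    have "Max (tsize ` ?T) \<in> tsize ` ?T" using fin nz by (intro Max_in) auto
    then show thesis using that fin by (metis (no_types, lifting) Max_ge finite_imageI imageE image_eqI)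
  qed
  let ?u = "\<lambda>k. bunch t0 (tsize t0 + k)"
  obtain F where F: "finite F" "\<And>k. Poly_Mapping.keys (((bracket (f Dd)) ^^ k) (Dp (bunch t0 (tsize t0)))) \<subseteq> F"
    using locally_finite[OF f] by blast
  have "GPlus (?u k) \<in> F" for k
    using not_locally_finite[of "f Dd" t0 k] t0 F(2)[of k] by (auto simp: in_keys_iff)
  then have "finite (range (\<lambda>k. GPlus (?u k)))"
    using F(1) by (meson finite_subset image_subsetI)
  moreover have "inj (\<lambda>k. GPlus (?u k))"
  proof (rule injI)
    fix k l assume "GPlus (?u k) = GPlus (?u l)"
    then have "rdeg (?u k) = rdeg (?u l)" by simp
    then show "k = l" by simp
  qed
  ultimately show False using finite_imageD infinite_UNIV_nat by blast
qed

text \<open>The coefficients at \<open>D\<^sub>t\<^sup>-\<close> are those of \<open>omega \<circ> f\<close> at \<open>D\<^sub>t\<^sup>+\<close> up to nonzero scalars.\<close>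

lemma aut_Dd_scalar:
  assumes f: "is_ie_aut f"
  shows "f Dd = lk (f Dd) GD *\<^sub>g Dd"
proof (rule poly_mapping_eqI)
  fix k
  have m: "lk (f Dd) (GMinus t) = 0" for t
    using aut_Dd_no_plus[OF aut_comp[OF omega_aut f], of t] flip_weight_nonzero[of "GMinus t"]
    by (simp add: lookup_omega del: flip_weight.simps)
  have "lk Dd GD = 1" "lk Dd (GPlus t) = 0" "lk Dd (GMinus t) = 0" for t
    by (simp_all add: Dd_def lookup_single)
  then show "lk (f Dd) k = lk (lk (f Dd) GD *\<^sub>g Dd) k"
    by (cases k) (simp_all add: aut_Dd_no_plus[OF f] m)
qed

text \<open>\<open>f\<close> maps eigenvectors of \<open>ad d\<close> to eigenvectors of \<open>ad (f d)\<close> with the same eigenvalue.\<close>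

lemma aut_weight_scaled:
  assumes f: "is_ie_aut f" and c: "f Dd = c *\<^sub>g Dd" and k: "lk (f (basis k)) j \<noteq> 0"
  shows "c * of_int (weight j) = of_int (weight k)"
proof -
  interpret A: Vector_Spaces.linear "(*\<^sub>g)" "(*\<^sub>g)" "\<lambda>x. bracket x (f (basis k))" by (rule bracket_bilinear(2))
  have "bracket Dd (basis k) = of_int (weight k) *\<^sub>g basis k"
    by (rule poly_mapping_eqI) (simp add: lookup_bracket_Dd lookup_single when_def)
  then have "of_int (weight k) *\<^sub>g f (basis k) = f (bracket Dd (basis k))"
    by (simp add: autD(7)[OF f])
  also have "\<dots> = c *\<^sub>g bracket Dd (f (basis k))"
    by (simp add: autD(3)[OF f] c A.scale)
  finally have "lk (of_int (weight k) *\<^sub>g f (basis k)) j = lk (c *\<^sub>g bracket Dd (f (basis k))) j" by simp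
  then show ?thesis using k by (simp add: lookup_bracket_Dd)
qed

lemma basis_nonzero: "basis k \<noteq> 0"
  by (metis lookup_single_eq lookup_zero zero_neq_one)

lemma aut_basis_key:
  assumes f: "is_ie_aut f"
  obtains j where "lk (f (basis k)) j \<noteq> 0"
proof -
  have "f (basis k) \<noteq> 0" using autD(8)[OF f, of "basis k" 0] autD(4)[OF f] basis_nonzero by simp
  then show thesis using that by (metis lookup_zero poly_mapping_eqI)
qed

text \<open>\<open>D\<^sup>+\<close> of the one-vertex tree has eigenvalue \<open>1\<close>, so \<open>c\<close> times some integer is \<open>1\<close>. The same holds for the
  inverse automorphism and \<open>1 / c\<close>, so \<open>c\<close> is itself an integer with integral inverse.\<close>

lemma aut_Dd_sign:
  assumes f: "is_ie_aut f"
  shows "f Dd = Dd \<or> f Dd = - Dd"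
proof -
  have inv: "\<exists>n::int. lk (f Dd) GD * of_int n = 1" if f: "is_ie_aut f" for f
  proof -
    obtain j where "lk (f (basis (GPlus dot))) j \<noteq> 0" by (rule aut_basis_key[OF f])
    from aut_weight_scaled[OF f aut_Dd_scalar[OF f] this] show ?thesis
      using tsize_dot by auto
  qed
  let ?c = "lk (f Dd) GD" and ?d = "lk (inv_into UNIV f Dd) GD"
  obtain n where n: "?c * of_int n = 1" using inv[OF f] by blast
  obtain m where m: "?d * of_int m = 1" using inv[OF aut_inv[OF f]] by blast
  have "f (inv_into UNIV f Dd) = Dd" using autD(2)[OF f] by (simp add: bij_is_surj surj_f_inv_f)
  then have "?d *\<^sub>g f Dd = Dd"
    by (metis aut_Dd_scalar[OF aut_inv[OF f]] autD(7)[OF f])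
  then have "lk (?d *\<^sub>g f Dd) GD = lk Dd GD" by simp
  then have dc: "?d * ?c = 1" by (simp add: Dd_def)
  have "?c = of_int m"
    using m dc by (metis mult.commute mult.left_commute mult_1_right)
  then have "(of_int (m * n) :: complex) = 1" using n by simp
  then have "m * n = 1" by (metis of_int_1 of_int_eq_iff)
  then have "m = 1 \<or> m = -1" by (rule zmult_eq_1_iff[THEN iffD1, THEN disj_forward]) auto
  then show ?thesis
    using aut_Dd_scalar[OF f] \<open>?c = of_int m\<close>
    by (auto intro!: poly_mapping_eqI)
qed

lemma aut_weight_abs:
  assumes f: "is_ie_aut f" and k: "lk (f (basis k)) j \<noteq> 0"
  shows "weight j = weight k \<or> weight j = - weight k"
proof -
  have "f Dd = 1 *\<^sub>g Dd \<or> f Dd = (-1) *\<^sub>g Dd"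
    using aut_Dd_sign[OF f] by (auto intro!: poly_mapping_eqI)
  then have "(of_int (weight j) :: complex) = of_int (weight k) \<or> (of_int (- weight j) :: complex) = of_int (weight k)"
    using aut_weight_scaled[OF f _ k] by fastforce
  then show ?thesis unfolding of_int_eq_iff by auto
qed

text \<open>A weight and its negative have the same parity.\<close>

lemma tau_minus_one_central:
  assumes f: "is_ie_aut f"
  shows "tau (-1) \<circ> f = f \<circ> tau (-1)"
proof (rule lin_eqI)
  show "lin (tau (-1) \<circ> f)" "lin (f \<circ> tau (-1))"
    using autD(1)[OF aut_comp] f tau_aut[of "-1"] by simp_all
  fix k
  have b: "tau (-1) (basis k) = (-1) powi weight k *\<^sub>g basis k"
    by (rule poly_mapping_eqI) (simp add: lookup_tau lookup_single when_def)
  show "(tau (-1) \<circ> f) (basis k) = (f \<circ> tau (-1)) (basis k)"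
  proof (rule poly_mapping_eqI)
    fix j
    have "(-1) powi weight j = ((-1) powi weight k :: complex)" if "lk (f (basis k)) j \<noteq> 0"
      using aut_weight_abs[OF f that] by (auto simp: power_int_minus power_int_minus_left)
    then show "lk ((tau (-1) \<circ> f) (basis k)) j = lk ((f \<circ> tau (-1)) (basis k)) j"
      by (cases "lk (f (basis k)) j = 0") (simp_all add: b autD(7)[OF f] lookup_tau)
  qed
qed

section \<open>The center\<close>

text \<open>Induction on the number of root branches of \<open>t\<close>: writing \<open>t = join r s\<close>, the coefficient at \<open>D\<^sub>r\<^sup>-\<close> in
  \<open>[y, D\<^sub>s\<^sup>+]\<close> involves \<open>t\<close> and trees with fewer root branches, whose coefficients are zero already.\<close>

lemma minus_part_detected:
  assumes y: "Poly_Mapping.keys y \<subseteq> GMinus ` {t. tsize t = n}" and n: "n \<noteq> 1"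
    and z: "\<And>s. tsize s < n \<Longrightarrow> bracket y (Dp s) = 0"
  shows "y = 0"
proof -
  have "lk y (GMinus t) = 0" if "tsize t = n" for t
    using that
  proof (induct "rdeg t" arbitrary: t rule: less_induct)
    case less
    obtain r s where t: "t = join r s" using tree_is_join[of t] less(2) n by blast
    have s: "tsize s < n" using tsize_join[of r s] tsize_pos[of r] t less(2) by simp
    have "lk (bracket y (Dp s)) (GMinus r) = lk y (GMinus t) * lk (Dp s) (GPlus s) * lk (gen_bracket (GMinus t) (GPlus s)) (GMinus r)"
    proof (rule lookup_bracket_unique)
      fix a b assume a: "a \<in> Poly_Mapping.keys y" and b: "b \<in> Poly_Mapping.keys (Dp s)"
        and nz: "lk (gen_bracket a b) (GMinus r) \<noteq> 0"
      have b: "b = GPlus s" using b by (simp add: Dp_def)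
      obtain t' where t': "a = GMinus t'" "tsize t' = n" using y a by blast
      have "beta t' s r \<noteq> 0" using nz b t' by (simp add: lookup_mixed)
      then have "t' = t \<or> rdeg t' < rdeg t" using beta_nonzero_cases[of t' s r] t by auto
      moreover have "\<not> rdeg t' < rdeg t" using less(1)[of t'] t' a by (auto simp: in_keys_iff)
      ultimately show "a = GMinus t \<and> b = GPlus s" using t' b by simp
    qed
    then show ?case using z[OF s] beta_join[of r s] t by (simp add: lookup_mixed Dp_def)
  qed
  then have "k \<notin> Poly_Mapping.keys y" for k using y by (auto simp: in_keys_iff)
  then show ?thesis by (intro poly_mapping_eqI) (simp add: in_keys_iff)
qed

text \<open>The number \<open>2\<close> serves only to make all powers \<open>2\<^sup>n\<close> distinct, so that eigenspaces of \<open>tau 2\<close> are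
  homogeneous components.\<close>

lemma commutes_tau_graded:
  assumes f: "is_ie_aut f" and c: "f \<circ> tau 2 = tau 2 \<circ> f" and j: "lk (f (basis k)) j \<noteq> 0"
  shows "weight j = weight k"
proof -
  have b: "tau 2 (basis k) = 2 powi weight k *\<^sub>g basis k"
    by (rule poly_mapping_eqI) (simp add: lookup_tau lookup_single when_def)
  have "f (tau 2 (basis k)) = tau 2 (f (basis k))" using fun_cong[OF c, of "basis k"] by simp
  then have "lk (2 powi weight k *\<^sub>g f (basis k)) j = lk (tau 2 (f (basis k))) j"
    by (simp add: b autD(7)[OF f])
  then have "(2 powi weight k :: complex) = 2 powi weight j" using j by (simp add: lookup_tau)
  then have "norm (2 powi weight k :: complex) = norm (2 powi weight j :: complex)" by simp
  then have "(2 :: real) powi weight k = 2 powi weight j" by (simp add: norm_power_int)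
  then show ?thesis
    by (metis linorder_neq_iff one_less_numeral_iff order_less_irrefl power_int_strict_increasing semiring_norm(76))
qed

lemma weight_1: "weight k = 1 \<longleftrightarrow> k = GPlus dot"
  using tsize_1_iff tsize_dot by (cases k) auto

lemma weight_minus: "weight k = - int n \<Longrightarrow> n > 0 \<Longrightarrow> \<exists>t. k = GMinus t \<and> tsize t = n"
  by (cases k) auto

lemma omega_transfer:
  assumes f: "is_ie_aut f" and c: "f \<circ> omega = omega \<circ> f" and a: "f (basis k) = a *\<^sub>g basis k"
  shows "f (basis (flip k)) = a *\<^sub>g basis (flip k)"
proof -
  have o: "omega (a *\<^sub>g basis k) = a *\<^sub>g omega (basis k)"
    by (rule autD(7)[OF omega_aut])
  have "f (omega (basis k)) = omega (f (basis k))" using fun_cong[OF c, of "basis k"] by simp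
  then have "flip_weight k *\<^sub>g f (basis (flip k)) = a *\<^sub>g flip_weight k *\<^sub>g basis (flip k)"
    by (simp add: a o omega_basis autD(7)[OF f])
  then have "lk (flip_weight k *\<^sub>g f (basis (flip k))) j = lk (a *\<^sub>g flip_weight k *\<^sub>g basis (flip k)) j" for j
    by simp
  then show ?thesis using flip_weight_nonzero[of k] by (intro poly_mapping_eqI) auto
qed

lemma scale_1: "1 *\<^sub>g x = x"
  by (rule poly_mapping_eqI) simp

text \<open>The induction is on the absolute value of the weight. In the step, \<open>[D\<^sub>t\<^sup>-, D\<^sub>s\<^sup>+]\<close> with \<open>|s| < |t|\<close> has smaller
  absolute weight, so it is fixed by \<open>f\<close>, just as \<open>D\<^sub>s\<^sup>+\<close>.\<close>

lemma central_fixing_dot_is_id: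
  assumes f: "is_ie_aut f" and t: "f \<circ> tau 2 = tau 2 \<circ> f" and o: "f \<circ> omega = omega \<circ> f"
    and d: "f (Dp dot) = Dp dot"
  shows "f = id"
proof -
  have flip_fix: "f (basis (flip k)) = basis (flip k)" if "f (basis k) = basis k" for k
    using omega_transfer[OF f o, of k 1] that by (simp add: scale_1)
  have "\<forall>k. nat \<bar>weight k\<bar> < n \<longrightarrow> f (basis k) = basis k" for n
  proof (induct n)
    case 0
    then show ?case by simp
  next
    case (Suc n)
    have minus: "f (Dm t) = Dm t" if t: "tsize t = n" for t
    proof (cases "n = 1")
      case True
      then have "t = dot" using t tsize_1_iff by simp
      then show ?thesis using flip_fix[of "GPlus dot"] d by (simp add: Dp_def Dm_def)
    next
      case False
      have n0: "n > 0" using t tsize_pos[of t] by simp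
      have fixes_low: "f y = y" if "\<And>k. k \<in> Poly_Mapping.keys y \<Longrightarrow> nat \<bar>weight k\<bar> < n" for y
      proof -
        have "f y = (\<Sum>k\<in>Poly_Mapping.keys y. lk y k *\<^sub>g basis k)"
          unfolding lin_expand[OF autD(1)[OF f], of y] using that Suc by (intro sum.cong) auto
        then show ?thesis using ie_expand[of y] by simp
      qed
      let ?y = "f (Dm t) - Dm t"
      have "?y = 0"
      proof (rule minus_part_detected[of _ n])
        show "Poly_Mapping.keys ?y \<subseteq> GMinus ` {t. tsize t = n}"
        proof
          fix k assume "k \<in> Poly_Mapping.keys ?y"
          then have "lk (f (Dm t)) k \<noteq> 0 \<or> lk (Dm t) k \<noteq> 0" by (auto simp: in_keys_iff lookup_minus)
          then have "weight k = - int n"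
            using commutes_tau_graded[OF f assms(2), of "GMinus t" k] t
            by (auto simp: Dm_def lookup_single when_def split: if_splits)
          then show "k \<in> GMinus ` {t. tsize t = n}" using weight_minus[OF _ n0] by blast
        qed
        fix s assume s: "tsize s < n"
        interpret A: Vector_Spaces.linear "(*\<^sub>g)" "(*\<^sub>g)" "\<lambda>x. bracket x (Dp s)" by (rule bracket_bilinear(2))
        have fs: "f (Dp s) = Dp s" using Suc s by (simp add: Dp_def)
        have "f (bracket (Dm t) (Dp s)) = bracket (Dm t) (Dp s)"
        proof (rule fixes_low)
          fix k assume "k \<in> Poly_Mapping.keys (bracket (Dm t) (Dp s))"
          then have "lk (gen_bracket (GMinus t) (GPlus s)) k \<noteq> 0"
            by (simp add: in_keys_iff Dm_def Dp_def bracket_single del: gen_bracket.simps)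
          then have "weight k = int (tsize s) - int n" using gen_bracket_weight t by fastforce
          then show "nat \<bar>weight k\<bar> < n" using s tsize_pos[of s] by linarith
        qed
        then have "bracket (f (Dm t)) (Dp s) = bracket (Dm t) (Dp s)"
          by (simp add: autD(3)[OF f] fs)
        then show "bracket ?y (Dp s) = 0" by (simp add: A.diff)
      qed (rule False)
      then show ?thesis by simp
    qed
    have plus: "f (Dp t) = Dp t" if "tsize t = n" for t
      using flip_fix[of "GMinus t"] minus[OF that] by (simp add: Dp_def Dm_def)
    have "f (Dm dot) = Dm dot" using flip_fix[of "GPlus dot"] d by (simp add: Dp_def Dm_def)
    then have D: "f Dd = Dd"
      using autD(3)[OF f, of "Dm dot" "Dp dot"] d by (simp only: bracket_relations(4))
    show ?case
    proof (intro allI impI)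
      fix k assume k: "nat \<bar>weight k\<bar> < Suc n"
      show "f (basis k) = basis k"
      proof (cases "nat \<bar>weight k\<bar> < n")
        case True
        then show ?thesis using Suc by blast
      next
        case False
        then have "nat \<bar>weight k\<bar> = n" using k by simp
        then show ?thesis using minus plus D by (cases k) (auto simp: Dm_def Dp_def Dd_def)
      qed
    qed
  qed
  then have "f (basis k) = basis k" for k by blast
  moreover have "lin id" by (simp add: Vector_Spaces.linear_iff vector_space_ie)
  ultimately show ?thesis using lin_eqI[OF autD(1)[OF f]] by simp
qed

text \<open>Since \<open>d\<close> is the bracket of \<open>D\<^sup>-\<close> and \<open>D\<^sup>+\<close> of the one-vertex tree, it is scaled by \<open>a\<^sup>2\<close>; as degrees are
  preserved, this factor is \<open>1\<close>.\<close>

lemma central_sign: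
  assumes f: "is_ie_aut f" and t: "f \<circ> tau 2 = tau 2 \<circ> f" and o: "f \<circ> omega = omega \<circ> f"
  shows "f (Dp dot) = Dp dot \<or> f (Dp dot) = - Dp dot"
proof -
  have "f (basis (GPlus dot)) = lk (f (basis (GPlus dot))) (GPlus dot) *\<^sub>g basis (GPlus dot)"
  proof (rule poly_mapping_eqI)
    fix k
    show "lk (f (basis (GPlus dot))) k =
        lk (lk (f (basis (GPlus dot))) (GPlus dot) *\<^sub>g basis (GPlus dot)) k"
      using commutes_tau_graded[OF f t, of "GPlus dot" k] weight_1[of k] tsize_dot
      by (auto simp: lookup_single when_def)
  qed
  then obtain a where a: "f (basis (GPlus dot)) = a *\<^sub>g basis (GPlus dot)"
    by blast
  then have am: "f (basis (GMinus dot)) = a *\<^sub>g basis (GMinus dot)"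
    using omega_transfer[OF f o a] by simp
  have "f Dd = bracket (a *\<^sub>g Dm dot) (a *\<^sub>g Dp dot)"
    using autD(3)[OF f, of "Dm dot" "Dp dot"] a[folded Dp_def] am[folded Dm_def]
    by (simp only: bracket_relations(4))
  then have D: "f Dd = (a * a) *\<^sub>g Dd"
    by (simp only: bracket_scale bracket_relations(4))
  obtain j where j: "lk (f (basis (GPlus dot))) j \<noteq> 0" by (rule aut_basis_key[OF f])
  then have "weight j = 1" using commutes_tau_graded[OF f t j] tsize_dot by simp
  then have "a * a = 1"
    using aut_weight_scaled[OF f D j] tsize_dot by simp
  then have "a = 1 \<or> a = -1" by (simp add: square_eq_1_iff)
  then show ?thesis
    using a by (auto simp: Dp_def intro!: poly_mapping_eqI)
qed

theorem corollary6p10: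
  shows "group_center Aut_ie = {id, tau_minus_one}"
proof (intro equalityI subsetI)
  fix f assume "f \<in> group_center Aut_ie"
  then have f: "is_ie_aut f" and c: "\<And>g. is_ie_aut g \<Longrightarrow> f \<circ> g = g \<circ> f"
    by (auto simp: group_center_def Aut_ie_def)
  have com: "f \<circ> tau 2 = tau 2 \<circ> f" "f \<circ> omega = omega \<circ> f"
    using c[OF tau_aut] c[OF omega_aut] by simp_all
  from central_sign[OF f com] show "f \<in> {id, tau_minus_one}"
  proof
    assume "f (Dp dot) = Dp dot"
    then show ?thesis using central_fixing_dot_is_id[OF f com] by simp
  next
    assume d: "f (Dp dot) = - Dp dot"
    let ?t = "tau (-1)"
    let ?g = "?t \<circ> f"
    have t: "is_ie_aut ?t" by (rule tau_aut) simp
    have g: "is_ie_aut ?g" by (rule aut_comp[OF t f])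
    have com': "?g \<circ> h = h \<circ> ?g" if "is_ie_aut h" for h
      using c[OF that] tau_minus_one_central[OF that] by (metis comp_assoc)
    have "?g (Dp dot) = ?t (- Dp dot)"
      using d by simp
    also have "\<dots> = Dp dot"
      using tsize_dot by (auto intro!: poly_mapping_eqI simp: lookup_tau Dp_def lookup_single when_def)
    finally have "?g = id"
      by (intro central_fixing_dot_is_id[OF g] com' tau_aut omega_aut) simp_all
    moreover have "?t \<circ> ?t = id"
      by (rule ext, rule poly_mapping_eqI) (simp add: lookup_tau mult.assoc[symmetric] power_int_mult_distrib[symmetric])
    ultimately have "f = ?t" by (metis comp_assoc comp_id id_comp)
    then show ?thesis by (simp add: tau_minus_one_eq)
  qed
next
  fix f assume "f \<in> {id, tau_minus_one}"
  moreover have "is_ie_aut id"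
    by (simp add: is_ie_aut_def Vector_Spaces.linear_iff vector_space_ie)
  moreover have "is_ie_aut tau_minus_one"
    unfolding tau_minus_one_eq by (rule tau_aut) simp
  ultimately show "f \<in> group_center Aut_ie"
    using tau_minus_one_central by (auto simp: group_center_def Aut_ie_def tau_minus_one_eq)
qed

end
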